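(* Fix $q\in\mathcal{P}$, and consider a process $\mathbb{P}$, a candidate controller $\mathbb{C}_q$ and a multi-estimator $\mathbb{E}$ (with smooth data, as described in the context), where $\mathbb{P}$ has relative degree $r$. Assume that: 1. the process $\mathbb{P}$ is strongly minimum-phase; 2. the system $\widetilde{\mathbb{EC}}_q$ (with input $\mathbf{e}_q^{r-1}$ and output $\mathbf{y}_q^{r}$) is input-to-output stable; 3. the controller $\mathbb{C}_q$ is 0-detectable; 4. the multi-estimator $\mathbb{E}$ is 0-detectable. Then the closed-loop system $$\dot x_{\mathbb{P}}=f_{\mathbb{P}}(x_{\mathbb{P}},h_{\mathbb{C}}(x_{\mathbb{C}},q)),\quad \dot x_{\mathbb{E}}=f_{\mathbb{E}}(x_{\mathbb{E}},h_{\mathbb{P}}(x_{\mathbb{P}}),h_{\mathbb{C}}(x_{\mathbb{C}},q)),\quad \dot x_{\mathbb{C}}=f_{\mathbb{C}}(x_{\mathbb{C}},h_{\mathbb{P}}(x_{\mathbb{P}}),q)$$ with output $e_q=h_q(x_{\mathbb{E}})-h_{\mathbb{P}}(x_{\mathbb{P}})$ is weakly 0-detectable of order $r$; that is, there exist $\beta\in\mathcal{KL}$ and $\gamma\in\mathcal{K}_\infty$ such that, with $x:=(x_{\mathbb{P}};x_{\mathbb{E}};x_{\mathbb{C}})$, for every initial state $x(0)$ the inequality $|x(t)|\le\beta(|x(0)|,t)+\gamma(\|\mathbf{e}_q^{r}\|_{[0,t]})$ holds as long as the solution exists.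
   Context: Notation: $|\cdot|$ is the Euclidean norm, $\|z\|_{[a,b]}$ is the essential supremum of $|z(s)|$ over $[a,b]$; for a scalar signal $z$, $\mathbf{z}^k:=(z;\dot z;\dots;z^{(k)})$. Class $\mathcal{K}$: continuous strictly increasing $\alpha:[0,\infty)\to[0,\infty)$ with $\alpha(0)=0$; class $\mathcal{K}_\infty$: unbounded class $\mathcal{K}$ functions; class $\mathcal{KL}$: $\beta:[0,\infty)^2\to[0,\infty)$ with $\beta(\cdot,t)\in\mathcal{K}$ for each $t$ and $\beta(s,t)$ decreasing to $0$ as $t\to\infty$ for each $s$. Inputs are locally essentially bounded measurable functions on $[0,\infty)$. Systems (all functions smooth; $u$ and $y$ scalar; $\mathcal{P}$ an index set): process $\mathbb{P}$: $\dot x_{\mathbb{P}}=f_{\mathbb{P}}(x_{\mathbb{P}},u)$, $y=h_{\mathbb{P}}(x_{\mathbb{P}})$; controller $\mathbb{C}_q$: $\dot x_{\mathbb{C}}=f_{\mathbb{C}}(x_{\mathbb{C}},y,q)$, $u_q=h_{\mathbb{C}}(x_{\mathbb{C}},q)$, with input $y$ and output $u_q$; multi-estimator $\mathbb{E}$: $\dot x_{\mathbb{E}}=f_{\mathbb{E}}(x_{\mathbb{E}},y,u)$, $y_p=h_p(x_{\mathbb{E}})$, $p\in\mathcal{P}$, with inputs $y,u$; for the fixed $q$ it is considered with output $y_q$. The estimation errors are $e_p:=y_p-y$. Injected system $\mathbb{EC}_q$: $\dot x_{\mathbb{E}}=f_{\mathbb{E}}(x_{\mathbb{E}},h_q(x_{\mathbb{E}})-e_q,h_{\mathbb{C}}(x_{\mathbb{C}},q))$,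 $\dot x_{\mathbb{C}}=f_{\mathbb{C}}(x_{\mathbb{C}},h_q(x_{\mathbb{E}})-e_q,q)$, with input $e_q$, state $(x_{\mathbb{E}},x_{\mathbb{C}})$ and outputs $u=h_{\mathbb{C}}(x_{\mathbb{C}},q)$ and $y_q=h_q(x_{\mathbb{E}})$. The system $\widetilde{\mathbb{EC}}_q$ is the same system with inputs $e_q\in C^{r-1}$, where the input is redefined to be $\mathbf{e}_q^{r-1}$ and the output to be $\mathbf{y}_q^{r}$ (the derivatives of $y_q$ up to order $r$ along solutions being functions of the state and of $e_q,\dots,e_q^{(r-1)}$). 0-detectability of a system with state $x$, input $v$, output $w$: there exist $\beta\in\mathcal{KL}$, $\gamma_1,\gamma_2\in\mathcal{K}_\infty$ such that for every initial state and input, $|x(t)|\le\beta(|x(0)|,t)+\gamma_1(\|v\|_{[0,t]})+\gamma_2(\|w\|_{[0,t]})$ as long as the solution exists. Input-to-output stability of a system with state $x$, input $v$, output $w$: there exist $\beta\in\mathcal{KL}$, $\gamma\in\mathcal{K}_\infty$ such that for every initial state and input, $|w(t)|\le\beta(|x(0)|,t)+\gamma(\|v\|_{[0,t]})$ along the corresponding solution. Relative degree and strong minimum-phase property of a SISO system $\dot x=f(x,u)$, $y=h(x)$: let $H_0:=h$ and $H_{k+1}(x,u_0,\dots,u_k):=\frac{\partial H_k}{\partial x}f(x,u_0)+\sum_{j=0}^{k-1}\frac{\partial H_k}{\partial u_j}u_{j+1}$. A positive integer $r$ is the relative degree if $H_k$ is independent of $u_0,\dots,u_{k-1}$ for each $k<r$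 and there exist $\rho_1,\rho_2\in\mathcal{K}_\infty$ with $|u_0|\le\rho_1(|x|)+\rho_2(|H_r(x,u_0)|)$ for all $x,u_0$. The system is strongly minimum-phase if it has a relative degree $r$ and there exist $\beta\in\mathcal{KL}$, $\gamma\in\mathcal{K}_\infty$ such that for every initial state and every input, $|x(t)|\le\beta(|x(0)|,t)+\gamma(\|\mathbf{y}^{r-1}\|_{[0,t]})$ as long as the solution exists (here $\mathbf{y}^{r-1}=(H_0(x);\dots;H_{r-1}(x))$). *)

theory Defs
  imports "HOL-Analysis.Analysis" "HOL-Probability.Essential_Supremum"
begin

section \<open>Comparison functions\<close>

text \<open>Comparison functions are total functions on the reals of which only the values at
  nonnegative arguments matter.\<close>

definition class_K :: "(real \<Rightarrow> real) set" where
  "class_K = {\<alpha>. continuous_on {0..} \<alpha> \<and> strict_mono_on {0..} \<alpha> \<and> \<alpha> 0 = 0}"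

definition class_K_inf :: "(real \<Rightarrow> real) set" where
  "class_K_inf = {\<alpha> \<in> class_K. \<not> bdd_above (\<alpha> ` {0..})}"

definition class_KL :: "(real \<Rightarrow> real \<Rightarrow> real) set" where
  "class_KL = {\<beta>. (\<forall>t\<ge>0. (\<lambda>s. \<beta> s t) \<in> class_K) \<and>
     (\<forall>s\<ge>0. antimono_on {0..} (\<beta> s) \<and> (\<beta> s \<longlongrightarrow> 0) at_top)}"


section \<open>Signals\<close>

text \<open>On a degenerate interval the essential supremum carries no information, so there the
  norm is taken to be the value at the point. For continuous signals this is the limit of the
  norms over shrinking intervals; it matters for outputs that depend directly on the input.\<close>

definition sup_norm :: "(real \<Rightarrow> 'a::real_normed_vector) \<Rightarrow> real \<Rightarrow> real \<Rightarrow> real" where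
  "sup_norm z a b =
     (if a = b then norm (z a)
      else enn2real (esssup (lebesgue_on {a..b}) (\<lambda>s. ennreal (norm (z s)))))"

definition inputs :: "(real \<Rightarrow> 'v::euclidean_space) set" where
  "inputs = {v. v \<in> borel_measurable (lebesgue_on {0..}) \<and>
     (\<forall>t\<ge>0. \<exists>B. AE s in lebesgue_on {0..t}. norm (v s) \<le> B)}"

text \<open>Vectors whose dimension \<open>n\<close> is a natural number variable are represented by functions on
  the natural numbers, of which only the components below \<open>n\<close> count.\<close>

abbreviation vec_norm :: "nat \<Rightarrow> (nat \<Rightarrow> real) \<Rightarrow> real" where
  "vec_norm n z \<equiv> L2_set z {..<n}"

text \<open>Derivatives relative to an interval \<open>I\<close> (one-sided at an endpoint belonging to \<open>I\<close>).\<close>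

primrec nth_deriv :: "real set \<Rightarrow> (real \<Rightarrow> real) \<Rightarrow> nat \<Rightarrow> real \<Rightarrow> real" where
  "nth_deriv I z 0 = z"
| "nth_deriv I z (Suc k) = (\<lambda>t. vector_derivative (nth_deriv I z k) (at t within I))"

definition C_on :: "nat \<Rightarrow> real set \<Rightarrow> (real \<Rightarrow> real) set" where
  "C_on n I = {z. (\<forall>k<n. \<forall>t\<in>I. nth_deriv I z k differentiable (at t within I)) \<and>
     continuous_on I (nth_deriv I z n)}"

definition jet :: "real set \<Rightarrow> (real \<Rightarrow> real) \<Rightarrow> real \<Rightarrow> nat \<Rightarrow> real" where
  "jet I z t = (\<lambda>k. nth_deriv I z k t)"


section \<open>Smooth maps\<close>

primrec C_diff :: "nat \<Rightarrow> ('a::euclidean_space \<Rightarrow> 'b::euclidean_space) \<Rightarrow> bool" where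
  "C_diff 0 f \<longleftrightarrow> continuous_on UNIV f"
| "C_diff (Suc n) f \<longleftrightarrow> (\<forall>x. f differentiable (at x)) \<and>
     (\<forall>v. C_diff n (\<lambda>x. frechet_derivative f (at x) v))"

definition smooth :: "('a::euclidean_space \<Rightarrow> 'b::euclidean_space) \<Rightarrow> bool" where
  "smooth f \<longleftrightarrow> (\<forall>n. C_diff n f)"


section \<open>Systems and their solutions\<close>

definition time_interval :: "ereal \<Rightarrow> real set" where
  "time_interval T = {t. 0 \<le> t \<and> ereal t < T}"

text \<open>Caratheodory solutions on the interval from \<open>0\<close> (included) to \<open>T\<close> (excluded), in integral
  form. A bound imposed on all solutions at all times of their interval is a bound on the
  maximal solutions as long as they exist.\<close>

definition solution ::
  "('x::euclidean_space \<Rightarrow> 'v \<Rightarrow> 'x) \<Rightarrow> (real \<Rightarrow> 'v) \<Rightarrow> ereal \<Rightarrow> (real \<Rightarrow> 'x) \<Rightarrow> bool" where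
  "solution f v T x \<longleftrightarrow> 0 < T \<and> continuous_on (time_interval T) x \<and>
     (\<forall>t\<in>time_interval T. ((\<lambda>s. f (x s) (v s)) has_integral (x t - x 0)) {0..t})"

definition zero_detectable ::
  "('x::euclidean_space \<Rightarrow> 'v::euclidean_space \<Rightarrow> 'x) \<Rightarrow> ('x \<Rightarrow> 'w::euclidean_space) \<Rightarrow> bool" where
  "zero_detectable f h \<longleftrightarrow>
     (\<exists>\<beta>\<in>class_KL. \<exists>\<gamma>1\<in>class_K_inf. \<exists>\<gamma>2\<in>class_K_inf. \<forall>v\<in>inputs. \<forall>T x.
        solution f v T x \<longrightarrow> (\<forall>t\<in>time_interval T.
          norm (x t) \<le> \<beta> (norm (x 0)) t + \<gamma>1 (sup_norm v 0 t)
            + \<gamma>2 (sup_norm (\<lambda>s. h (x s)) 0 t)))"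

text \<open>The system has \<open>m\<close>-dimensional inputs, ranging over the set \<open>V\<close> of signals, and
  \<open>n\<close>-dimensional outputs \<open>h x v\<close>.\<close>

definition input_to_output_stable ::
  "nat \<Rightarrow> nat \<Rightarrow> ('x::euclidean_space \<Rightarrow> (nat \<Rightarrow> real) \<Rightarrow> 'x) \<Rightarrow>
   ('x \<Rightarrow> (nat \<Rightarrow> real) \<Rightarrow> nat \<Rightarrow> real) \<Rightarrow> (real \<Rightarrow> nat \<Rightarrow> real) set \<Rightarrow> bool" where
  "input_to_output_stable m n f h V \<longleftrightarrow>
     (\<exists>\<beta>\<in>class_KL. \<exists>\<gamma>\<in>class_K_inf. \<forall>v\<in>V. \<forall>T x.
        solution f v T x \<longrightarrow> (\<forall>t\<in>time_interval T.
          vec_norm n (h (x t) (v t)) \<le> \<beta> (norm (x 0)) t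
            + \<gamma> (sup_norm (\<lambda>s. vec_norm m (v s)) 0 t)))"

text \<open>The function \<open>H\<^sub>k(x, u\<^sub>0, \<dots>, u\<^sub>k\<^sub>-\<^sub>1)\<close> giving the \<open>k\<close>-th derivative of the output along
  solutions; the argument \<open>u\<close> is the sequence \<open>u\<^sub>0, u\<^sub>1, \<dots>\<close>.\<close>

primrec output_deriv ::
  "('x::euclidean_space \<Rightarrow> real \<Rightarrow> 'x) \<Rightarrow> ('x \<Rightarrow> real) \<Rightarrow> nat \<Rightarrow> 'x \<Rightarrow> (nat \<Rightarrow> real) \<Rightarrow> real" where
  "output_deriv f h 0 = (\<lambda>x u. h x)"
| "output_deriv f h (Suc k) = (\<lambda>x u.
     frechet_derivative (\<lambda>\<xi>. output_deriv f h k \<xi> u) (at x) (f x (u 0))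
     + (\<Sum>j<k. deriv (\<lambda>c. output_deriv f h k x (u(j := c))) (u j) * u (Suc j)))"

definition relative_degree ::
  "('x::euclidean_space \<Rightarrow> real \<Rightarrow> 'x) \<Rightarrow> ('x \<Rightarrow> real) \<Rightarrow> nat \<Rightarrow> bool" where
  "relative_degree f h r \<longleftrightarrow> 0 < r \<and>
     (\<forall>k<r. \<forall>x u u'. output_deriv f h k x u = output_deriv f h k x u') \<and>
     (\<exists>\<rho>1\<in>class_K_inf. \<exists>\<rho>2\<in>class_K_inf. \<forall>x u.
        \<bar>u 0\<bar> \<le> \<rho>1 (norm x) + \<rho>2 \<bar>output_deriv f h r x u\<bar>)"

text \<open>Below the relative degree the functions \<open>H\<^sub>k\<close> do not depend on the input argument, which
  is therefore filled with zeros.\<close>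

definition strongly_minimum_phase ::
  "('x::euclidean_space \<Rightarrow> real \<Rightarrow> 'x) \<Rightarrow> ('x \<Rightarrow> real) \<Rightarrow> bool" where
  "strongly_minimum_phase f h \<longleftrightarrow>
     (\<exists>r. relative_degree f h r \<and>
       (\<exists>\<beta>\<in>class_KL. \<exists>\<gamma>\<in>class_K_inf. \<forall>u\<in>inputs. \<forall>T x.
          solution f u T x \<longrightarrow> (\<forall>t\<in>time_interval T.
            norm (x t) \<le> \<beta> (norm (x 0)) t
              + \<gamma> (sup_norm (\<lambda>s. vec_norm r (\<lambda>k. output_deriv f h k (x s) (\<lambda>_. 0))) 0 t))))"

text \<open>For an autonomous system with smooth right-hand side and scalar output, whose solutions
  are classical.\<close>

definition weakly_zero_detectable ::
  "('x::euclidean_space \<Rightarrow> 'x) \<Rightarrow> ('x \<Rightarrow> real) \<Rightarrow> nat \<Rightarrow> bool" where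
  "weakly_zero_detectable F h r \<longleftrightarrow>
     (\<exists>\<beta>\<in>class_KL. \<exists>\<gamma>\<in>class_K_inf. \<forall>T x.
        0 < T \<and> (\<forall>t\<in>time_interval T.
          (x has_vector_derivative F (x t)) (at t within time_interval T)) \<longrightarrow>
        (\<forall>t\<in>time_interval T.
          norm (x t) \<le> \<beta> (norm (x 0)) t
            + \<gamma> (sup_norm (\<lambda>s. vec_norm (Suc r) (jet (time_interval T) (\<lambda>\<tau>. h (x \<tau>)) s)) 0 t)))"


section \<open>The interconnections\<close>

text \<open>In the following, \<open>fE\<close> takes the state and the inputs \<open>y\<close>, \<open>u\<close>, in this order; \<open>fC\<close>, \<open>hC\<close>
  and \<open>hq\<close> are the data for the fixed index \<open>q\<close>.\<close>

definition injected_field ::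
  "('e \<Rightarrow> real \<Rightarrow> real \<Rightarrow> 'e) \<Rightarrow> ('e \<Rightarrow> real) \<Rightarrow> ('c \<Rightarrow> real \<Rightarrow> 'c) \<Rightarrow> ('c \<Rightarrow> real) \<Rightarrow>
   'e \<times> 'c \<Rightarrow> real \<Rightarrow> 'e \<times> 'c" where
  "injected_field fE hq fC hC = (\<lambda>(xE, xC) e.
     (fE xE (hq xE - e) (hC xC), fC xC (hq xE - e)))"

definition injected_ios ::
  "('e::euclidean_space \<Rightarrow> real \<Rightarrow> real \<Rightarrow> 'e) \<Rightarrow> ('e \<Rightarrow> real) \<Rightarrow>
   ('c::euclidean_space \<Rightarrow> real \<Rightarrow> 'c) \<Rightarrow> ('c \<Rightarrow> real) \<Rightarrow> nat \<Rightarrow> bool" where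
  "injected_ios fE hq fC hC r \<longleftrightarrow>
     input_to_output_stable r (Suc r)
       (\<lambda>x v. injected_field fE hq fC hC x (v 0))
       (\<lambda>x v k. output_deriv (injected_field fE hq fC hC) (\<lambda>(xE, xC). hq xE) k x v)
       (jet {0..} ` C_on (r - 1) {0..})"

definition closed_loop_field ::
  "('p \<Rightarrow> real \<Rightarrow> 'p) \<Rightarrow> ('p \<Rightarrow> real) \<Rightarrow> ('e \<Rightarrow> real \<Rightarrow> real \<Rightarrow> 'e) \<Rightarrow>
   ('c \<Rightarrow> real \<Rightarrow> 'c) \<Rightarrow> ('c \<Rightarrow> real) \<Rightarrow> 'p \<times> 'e \<times> 'c \<Rightarrow> 'p \<times> 'e \<times> 'c" where
  "closed_loop_field fP hP fE fC hC = (\<lambda>(xP, xE, xC).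
     (fP xP (hC xC), fE xE (hP xP) (hC xC), fC xC (hP xP)))"

end

(* The output y_q of the injected system is, with its derivatives, bounded by the initial state and
   by the derivatives of e_q (stability of EC_q), hence so is y = y_q - e_q. This bounds the process
   state (minimum phase), then u (relative degree), then the states of the controller and of the
   multi-estimator (detectability). Every passage from driving signals to a state is the cascade
   argument that restarts the estimate at t / 2. *)
theory Submission
  imports Defs
begin

section \<open>Smooth maps\<close>

text \<open>With e_q as its input, the pair of estimator and controller sees the process only
  through y = y_q - e_q. Hence y_q can be bounded before anything is known about the process state
  or u. Detectability of the controller takes u as given, so u has to be recovered from the process,
  out of y and its first r derivatives; since y^(r) = y_q^(r) - e_q^(r), this is what brings e_q^(r)
  into the conclusion.

  Three mismatches shape the proof. The hypotheses concern solutions started at 0 and inputs on the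
  half-line, but are applied to pieces of a trajectory that may exist for a finite time only: inputs
  are shifted and extended. The H_k are formal expressions, equal to derivatives of the output only
  along sufficiently smooth signals: smoothness comes from the closed loop as one autonomous system.
  Finally, the comparison functions must be the same for all trajectories, so every estimate is a
  statement about a family of signals indexed by trajectories.\<close>

lemma frechet_derivative_eqI:
  assumes "\<And>x. (f has_derivative f' x) (at x)"
  shows "frechet_derivative f (at x) = f' x"
  using frechet_derivative_at[OF assms] by simp

text \<open>\<open>C_diff\<close> refers to the choice-valued \<open>frechet_derivative\<close>.
  With an explicit derivative in its place, the closure properties below become the usual
  differentiation rules plus induction on the order.\<close>

lemma C_diff_SucI:
  assumes "\<And>x. (f has_derivative f' x) (at x)" and "\<And>v. C_diff n (\<lambda>x. f' x v)"
  shows "C_diff (Suc n) f"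
proof -
  have "f differentiable (at x)" for x
    using assms(1) differentiable_def by blast
  then show ?thesis
    using assms(2) by (simp add: frechet_derivative_eqI[OF assms(1)])
qed

lemma C_diff_SucD:
  assumes "C_diff (Suc n) f"
  shows "(f has_derivative frechet_derivative f (at x)) (at x)"
    and "C_diff n (\<lambda>x. frechet_derivative f (at x) v)"
  using assms by (auto simp: frechet_derivative_works)

lemma C_diff_Suc_lower: "C_diff (Suc n) f \<Longrightarrow> C_diff n f"
proof (induction n arbitrary: f)
  case 0
  then show ?case
    using differentiable_imp_continuous_within[of f _ UNIV]
    by (auto simp: continuous_on_eq_continuous_within)
next
  case (Suc n)
  show ?case
    by (rule C_diff_SucI[OF C_diff_SucD(1)[OF Suc.prems]])
      (rule Suc.IH[OF C_diff_SucD(2)[OF Suc.prems]])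
qed

lemma C_diff_const: "C_diff n (\<lambda>x. c)"
proof (induction n arbitrary: c)
  case (Suc n)
  show ?case
    by (rule C_diff_SucI[of _ "\<lambda>x v. 0"]) (use Suc in auto)
qed auto

lemma C_diff_bounded_linear_comp:
  assumes "bounded_linear L"
  shows "C_diff n f \<Longrightarrow> C_diff n (\<lambda>x. L (f x))"
proof (induction n arbitrary: f)
  case 0
  then show ?case
    using assms by (simp add: bounded_linear.continuous_on)
next
  case (Suc n)
  show ?case
    by (rule C_diff_SucI[OF bounded_linear.has_derivative[OF assms C_diff_SucD(1)[OF Suc.prems]]])
      (intro Suc.IH C_diff_SucD(2)[OF Suc.prems])
qed

lemma C_diff_bounded_linear:
  assumes "bounded_linear L"
  shows "C_diff n L"
proof (cases n)
  case 0
  then show ?thesis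
    using assms by (simp add: linear_continuous_on)
next
  case (Suc m)
  show ?thesis unfolding Suc
    by (rule C_diff_SucI[OF bounded_linear_imp_has_derivative[OF assms] C_diff_const])
qed

lemma C_diff_add: "C_diff n f \<Longrightarrow> C_diff n g \<Longrightarrow> C_diff n (\<lambda>x. f x + g x)"
proof (induction n arbitrary: f g)
  case 0
  then show ?case by (simp add: continuous_on_add)
next
  case (Suc n)
  show ?case
    by (rule C_diff_SucI[OF has_derivative_add[OF C_diff_SucD(1)[OF Suc.prems(1)]
            C_diff_SucD(1)[OF Suc.prems(2)]]])
      (intro Suc.IH C_diff_SucD(2) Suc.prems)
qed

lemma C_diff_sum:
  "finite A \<Longrightarrow> (\<And>i. i \<in> A \<Longrightarrow> C_diff n (f i)) \<Longrightarrow> C_diff n (\<lambda>x. \<Sum>i\<in>A. f i x)"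
  by (induction A rule: finite_induct) (auto intro: C_diff_add C_diff_const)

lemma C_diff_scaleR:
  fixes f :: "'a::euclidean_space \<Rightarrow> real" and g :: "'a \<Rightarrow> 'b::euclidean_space"
  shows "C_diff n f \<Longrightarrow> C_diff n g \<Longrightarrow> C_diff n (\<lambda>x. f x *\<^sub>R g x)"
proof (induction n arbitrary: f g)
  case 0
  then show ?case by (simp add: continuous_on_scaleR)
next
  case (Suc n)
  show ?case
    by (rule C_diff_SucI[OF has_derivative_scaleR[OF C_diff_SucD(1)[OF Suc.prems(1)]
            C_diff_SucD(1)[OF Suc.prems(2)]]])
      (intro C_diff_add Suc.IH C_diff_SucD(2) Suc.prems C_diff_Suc_lower)
qed

text \<open>\<open>C_diff\<close> controls derivatives in fixed directions only. In a chain rule the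
  direction moves with the point; expanding it in the basis leaves fixed directions, with scalar
  coefficients that vary smoothly.\<close>

lemma linear_eq_sum_Basis:
  fixes v :: "'a::euclidean_space"
  assumes "linear L"
  shows "L v = (\<Sum>b\<in>Basis. (v \<bullet> b) *\<^sub>R L b)"
  by (subst euclidean_representation[symmetric, of v])
    (simp add: linear_sum[OF assms] linear_scale[OF assms] del: euclidean_representation)

lemma C_diff_compose: "C_diff n f \<Longrightarrow> C_diff n g \<Longrightarrow> C_diff n (\<lambda>x. f (g x))"
proof (induction n arbitrary: f g)
  case 0
  then show ?case
    by (auto intro: continuous_on_compose2)
next
  case (Suc n)
  let ?f' = "\<lambda>y. frechet_derivative f (at y)" and ?g' = "\<lambda>x. frechet_derivative g (at x)"
  note f = C_diff_SucD[OF Suc.prems(1)] and g = C_diff_SucD[OF Suc.prems(2)]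
  have deriv: "((\<lambda>x. f (g x)) has_derivative (\<lambda>v. ?f' (g x) (?g' x v))) (at x)" for x
    by (rule has_derivative_compose[OF g(1) f(1)])
  have "C_diff n (\<lambda>x. ?f' (g x) (?g' x v))" for v
  proof -
    have eq: "?f' (g x) (?g' x v) = (\<Sum>b\<in>Basis. (?g' x v \<bullet> b) *\<^sub>R ?f' (g x) b)" for x
      by (rule linear_eq_sum_Basis) (rule has_derivative_linear[OF f(1)])
    show ?thesis unfolding eq
      by (intro C_diff_sum C_diff_scaleR finite_Basis
          C_diff_bounded_linear_comp[OF bounded_linear_inner_left] g(2)
          Suc.IH[OF f(2)] C_diff_Suc_lower[OF Suc.prems(2)])
  qed
  then show ?case by (rule C_diff_SucI[OF deriv])
qed

section \<open>The calculus of infinitely differentiable maps\<close>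

named_theorems smooth_intros

lemma smooth_const [smooth_intros]: "smooth (\<lambda>x. c)"
  by (simp add: smooth_def C_diff_const)

lemma smooth_bounded_linear: "bounded_linear L \<Longrightarrow> smooth L"
  by (simp add: smooth_def C_diff_bounded_linear)

lemma smooth_ident [smooth_intros]: "smooth (\<lambda>x. x)"
  by (rule smooth_bounded_linear[OF bounded_linear_ident])

lemma smooth_compose: "smooth f \<Longrightarrow> smooth g \<Longrightarrow> smooth (\<lambda>x. f (g x))"
  by (simp add: smooth_def C_diff_compose)

lemma smooth_fst [smooth_intros]: "smooth f \<Longrightarrow> smooth (\<lambda>x. fst (f x))"
  by (rule smooth_compose[OF smooth_bounded_linear[OF bounded_linear_fst]])

lemma smooth_snd [smooth_intros]: "smooth f \<Longrightarrow> smooth (\<lambda>x. snd (f x))"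
  by (rule smooth_compose[OF smooth_bounded_linear[OF bounded_linear_snd]])

lemma smooth_inner_const [smooth_intros]: "smooth f \<Longrightarrow> smooth (\<lambda>x. f x \<bullet> b)"
  by (rule smooth_compose[OF smooth_bounded_linear[OF bounded_linear_inner_left]])

lemma smooth_minus: "smooth f \<Longrightarrow> smooth (\<lambda>x. - f x)"
  by (rule smooth_compose[OF smooth_bounded_linear[OF bounded_linear_minus[OF bounded_linear_ident]]])

lemma smooth_add [smooth_intros]: "smooth f \<Longrightarrow> smooth g \<Longrightarrow> smooth (\<lambda>x. f x + g x)"
  by (simp add: smooth_def C_diff_add)

lemma smooth_diff [smooth_intros]: "smooth f \<Longrightarrow> smooth g \<Longrightarrow> smooth (\<lambda>x. f x - g x)"
  using smooth_add[OF _ smooth_minus] by fastforce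

lemma smooth_sum [smooth_intros]:
  "finite A \<Longrightarrow> (\<And>i. i \<in> A \<Longrightarrow> smooth (f i)) \<Longrightarrow> smooth (\<lambda>x. \<Sum>i\<in>A. f i x)"
  by (simp add: smooth_def C_diff_sum)

lemma smooth_scaleR [smooth_intros]:
  fixes f :: "'a::euclidean_space \<Rightarrow> real" and g :: "'a \<Rightarrow> 'b::euclidean_space"
  shows "smooth f \<Longrightarrow> smooth g \<Longrightarrow> smooth (\<lambda>x. f x *\<^sub>R g x)"
  by (simp add: smooth_def C_diff_scaleR)

lemma smooth_Pair [smooth_intros]:
  assumes "smooth f" and "smooth g"
  shows "smooth (\<lambda>x. (f x, g x))"
proof -
  have "smooth (\<lambda>y. (y, 0))" "smooth (\<lambda>z. (0, z))"
    by (intro smooth_bounded_linear bounded_linear_Pair bounded_linear_ident bounded_linear_zero)+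
  from smooth_add[OF smooth_compose[OF this(1) assms(1)] smooth_compose[OF this(2) assms(2)]]
  show ?thesis by simp
qed

lemma smooth_has_derivative: "smooth f \<Longrightarrow> (f has_derivative frechet_derivative f (at x)) (at x)"
  unfolding smooth_def by (rule C_diff_SucD(1)) (erule spec)

lemma smooth_frechet_derivative [smooth_intros]:
  assumes "smooth f" and "smooth g"
  shows "smooth (\<lambda>x. frechet_derivative f (at x) (g x))"
proof -
  have "smooth (\<lambda>x. frechet_derivative f (at x) b)" for b
    using assms(1) C_diff_SucD(2) unfolding smooth_def by blast
  moreover have "frechet_derivative f (at x) (g x)
      = (\<Sum>b\<in>Basis. (g x \<bullet> b) *\<^sub>R frechet_derivative f (at x) b)" for x
    by (rule linear_eq_sum_Basis) (rule has_derivative_linear[OF smooth_has_derivative[OF assms(1)]])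
  ultimately show ?thesis
    by (simp add: smooth_intros assms(2))
qed

section \<open>The chain rule for output derivatives\<close>

text \<open>The functions \<open>H\<^sub>k\<close> belong to this class (polynomial in \<open>u\<^sub>1, u\<^sub>2, \<dots>\<close> with coefficients smooth in
  \<open>(x, u\<^sub>0)\<close>), so the chain rule follows by rule induction, without any joint differentiability
  on the infinite-dimensional type of the sequences \<open>u\<close>.\<close>

inductive jet_polynomial :: "('x::euclidean_space \<Rightarrow> (nat \<Rightarrow> real) \<Rightarrow> real) \<Rightarrow> bool" where
  smooth: "smooth a \<Longrightarrow> jet_polynomial (\<lambda>x u. a (x, u 0))"
| coordinate: "jet_polynomial (\<lambda>x u. u j)"
| add: "jet_polynomial G \<Longrightarrow> jet_polynomial K \<Longrightarrow> jet_polynomial (\<lambda>x u. G x u + K x u)"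
| mult: "jet_polynomial G \<Longrightarrow> jet_polynomial K \<Longrightarrow> jet_polynomial (\<lambda>x u. G x u * K x u)"

text \<open>The recursion of \<open>output_deriv\<close> splits into this term and terms with
  \<open>input_deriv j\<close>. Named separately, each has its own sum and product rule.\<close>

definition state_deriv ::
  "('x::euclidean_space \<Rightarrow> real \<Rightarrow> 'x) \<Rightarrow> ('x \<Rightarrow> (nat \<Rightarrow> real) \<Rightarrow> real) \<Rightarrow> 'x \<Rightarrow> (nat \<Rightarrow> real) \<Rightarrow> real" where
  "state_deriv f G x u = frechet_derivative (\<lambda>\<xi>. G \<xi> u) (at x) (f x (u 0))"

definition input_deriv ::
  "nat \<Rightarrow> ('x \<Rightarrow> (nat \<Rightarrow> real) \<Rightarrow> real) \<Rightarrow> 'x \<Rightarrow> (nat \<Rightarrow> real) \<Rightarrow> real" where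
  "input_deriv j G x u = deriv (\<lambda>c. G x (u(j := c))) (u j)"

lemma output_deriv_Suc:
  "output_deriv f h (Suc k) x u =
     state_deriv f (output_deriv f h k) x u
     + (\<Sum>j<k. input_deriv j (output_deriv f h k) x u * u (Suc j))"
  by (simp add: state_deriv_def input_deriv_def)

lemma smooth_has_derivative_state:
  assumes "smooth a"
  shows "((\<lambda>\<xi>. a (\<xi>, c)) has_derivative (\<lambda>v. frechet_derivative a (at (x, c)) (v, 0))) (at x)"
  by (rule has_derivative_compose[OF _ smooth_has_derivative[OF assms]])
    (auto intro!: derivative_eq_intros)

lemma smooth_has_real_derivative_input:
  fixes a :: "'x::euclidean_space \<times> real \<Rightarrow> real"
  assumes "smooth a"
  shows "((\<lambda>c. a (x, c)) has_real_derivative frechet_derivative a (at (x, c)) (0, 1)) (at c)"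
proof -
  have "((\<lambda>c. a (x, c)) has_derivative (\<lambda>v. frechet_derivative a (at (x, c)) (0, v))) (at c)"
    by (rule has_derivative_compose[OF _ smooth_has_derivative[OF assms]])
      (auto intro!: derivative_eq_intros)
  moreover have "(\<lambda>v. frechet_derivative a (at (x, c)) (0, v))
      = (*) (frechet_derivative a (at (x, c)) (0, 1))"
  proof
    fix v
    show "frechet_derivative a (at (x, c)) (0, v) = frechet_derivative a (at (x, c)) (0, 1) * v"
      using linear_scale[OF has_derivative_linear[OF smooth_has_derivative[OF assms, of "(x, c)"]],
          of v "(0, 1)"] by (simp add: mult.commute)
  qed
  ultimately show ?thesis by (simp add: has_field_derivative_def)
qed

lemma jet_polynomial_const: "jet_polynomial (\<lambda>x u. c)"
  using jet_polynomial.smooth[OF smooth_const] .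

lemma jet_polynomial_sum:
  "finite A \<Longrightarrow> (\<And>i. i \<in> A \<Longrightarrow> jet_polynomial (G i)) \<Longrightarrow> jet_polynomial (\<lambda>x u. \<Sum>i\<in>A. G i x u)"
  by (induction A rule: finite_induct) (auto intro: jet_polynomial.add jet_polynomial_const)

lemma jet_polynomial_has_derivative_state:
  "jet_polynomial G \<Longrightarrow>
    ((\<lambda>\<xi>. G \<xi> u) has_derivative frechet_derivative (\<lambda>\<xi>. G \<xi> u) (at x)) (at x)"
  unfolding frechet_derivative_works[symmetric]
proof (induction rule: jet_polynomial.induct)
  case (smooth a)
  show ?case
    using smooth_has_derivative_state[OF smooth] differentiable_def by blast
qed auto

lemma jet_polynomial_has_derivative_input:
  "jet_polynomial G \<Longrightarrow>
    ((\<lambda>c. G x (u(j := c))) has_real_derivative input_deriv j G x u) (at (u j))"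
  unfolding input_deriv_def DERIV_deriv_iff_field_differentiable
proof (induction rule: jet_polynomial.induct)
  case (smooth a)
  show ?case
    using smooth_has_real_derivative_input[OF smooth]
    by (cases "j = 0") (auto simp: field_differentiable_def intro!: exI)
next
  case (coordinate i)
  show ?case by (cases "i = j") auto
qed (auto intro: field_differentiable_add field_differentiable_mult)

text \<open>Equations between functions rather than at a point, so that they rewrite under
  \<open>jet_polynomial\<close>.\<close>

lemma state_deriv_simps:
  fixes f :: "'x::euclidean_space \<Rightarrow> real \<Rightarrow> 'x"
  shows "smooth a \<Longrightarrow>
      state_deriv f (\<lambda>x u. a (x, u 0)) = (\<lambda>x u. frechet_derivative a (at (x, u 0)) (f x (u 0), 0))"
    and "state_deriv f (\<lambda>x u. u j) = (\<lambda>x u. 0)"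
    and "jet_polynomial G \<Longrightarrow> jet_polynomial K \<Longrightarrow>
      state_deriv f (\<lambda>x u. G x u + K x u) = (\<lambda>x u. state_deriv f G x u + state_deriv f K x u)"
    and "jet_polynomial G \<Longrightarrow> jet_polynomial K \<Longrightarrow>
      state_deriv f (\<lambda>x u. G x u * K x u)
        = (\<lambda>x u. G x u * state_deriv f K x u + state_deriv f G x u * K x u)"
  unfolding state_deriv_def
  subgoal by (intro ext, subst frechet_derivative_at[symmetric, OF smooth_has_derivative_state]) auto
  subgoal by simp
  subgoal
    by (intro ext, subst frechet_derivative_at[symmetric,
          OF has_derivative_add[OF jet_polynomial_has_derivative_state
            jet_polynomial_has_derivative_state]]) auto
  subgoal
    by (intro ext, subst frechet_derivative_at[symmetric,
          OF has_derivative_mult[OF jet_polynomial_has_derivative_state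
            jet_polynomial_has_derivative_state]]) auto
  done

lemma input_deriv_simps:
  fixes G K :: "'x::euclidean_space \<Rightarrow> (nat \<Rightarrow> real) \<Rightarrow> real"
  shows "smooth a \<Longrightarrow> input_deriv j (\<lambda>x u. a (x, u 0))
      = (\<lambda>x u. if j = 0 then frechet_derivative a (at (x, u 0)) (0, 1) else 0)"
    and "input_deriv j (\<lambda>x u. u i) = (\<lambda>x u. if i = j then 1 else 0)"
    and "jet_polynomial G \<Longrightarrow> jet_polynomial K \<Longrightarrow>
      input_deriv j (\<lambda>x u. G x u + K x u) = (\<lambda>x u. input_deriv j G x u + input_deriv j K x u)"
    and "jet_polynomial G \<Longrightarrow> jet_polynomial K \<Longrightarrow>
      input_deriv j (\<lambda>x u. G x u * K x u)
        = (\<lambda>x u. input_deriv j G x u * K x u + input_deriv j K x u * G x u)"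
  subgoal
    unfolding input_deriv_def
    by (intro ext) (auto intro: DERIV_imp_deriv[OF smooth_has_real_derivative_input])
  subgoal
    unfolding input_deriv_def by (intro ext) auto
  subgoal
    by (intro ext, subst input_deriv_def, rule DERIV_imp_deriv,
        rule DERIV_add[OF jet_polynomial_has_derivative_input jet_polynomial_has_derivative_input])
  subgoal premises prems
  proof (intro ext)
    fix x u
    show "input_deriv j (\<lambda>x u. G x u * K x u) x u
        = input_deriv j G x u * K x u + input_deriv j K x u * G x u"
      using DERIV_imp_deriv[OF DERIV_mult[OF
            jet_polynomial_has_derivative_input[OF prems(1), of x u j]
            jet_polynomial_has_derivative_input[OF prems(2), of x u j]]]
      by (simp add: input_deriv_def)
  qed
  done

text \<open>Since f reads only u_0 from the sequence, the derivative of a smooth \<open>a\<close>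
  along f is again a smooth function of (x, u_0); the remaining cases are algebra.\<close>

lemma jet_polynomial_state_deriv:
  assumes f: "smooth (\<lambda>(x, c). f x c)"
  shows "jet_polynomial G \<Longrightarrow> jet_polynomial (state_deriv f G)"
proof (induction rule: jet_polynomial.induct)
  case (smooth a)
  have "smooth (\<lambda>z. frechet_derivative a (at z) (f (fst z) (snd z), 0))"
    using f by (intro smooth_intros smooth) (simp add: case_prod_unfold)
  from jet_polynomial.smooth[OF this] show ?case
    by (simp add: state_deriv_simps(1)[OF smooth])
qed (auto simp: state_deriv_simps intro: jet_polynomial.intros jet_polynomial_const)

lemma jet_polynomial_input_deriv: "jet_polynomial G \<Longrightarrow> jet_polynomial (input_deriv j G)"
proof (induction rule: jet_polynomial.induct)
  case (smooth a)
  have "smooth (\<lambda>z. if j = 0 then frechet_derivative a (at z) (0, 1) else 0)"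
    by (cases "j = 0") (auto intro!: smooth_intros smooth)
  from jet_polynomial.smooth[OF this] show ?case
    by (simp add: input_deriv_simps(1)[OF smooth])
qed (auto simp: input_deriv_simps intro: jet_polynomial.intros jet_polynomial_const)

lemma jet_polynomial_output_deriv:
  assumes "smooth (\<lambda>(x, c). f x c)" and "smooth h"
  shows "jet_polynomial (output_deriv f h k)"
proof (induction k)
  case 0
  have "smooth (\<lambda>z. h (fst z))"
    by (intro smooth_compose[OF assms(2)] smooth_intros)
  from jet_polynomial.smooth[OF this] show ?case by simp
next
  case (Suc k)
  have "output_deriv f h (Suc k) = (\<lambda>x u. state_deriv f (output_deriv f h k) x u
     + (\<Sum>j<k. input_deriv j (output_deriv f h k) x u * u (Suc j)))"
    by (intro ext) (rule output_deriv_Suc)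
  then show ?case
    using Suc by (auto intro!: jet_polynomial.add jet_polynomial_sum jet_polynomial.mult
        jet_polynomial.coordinate jet_polynomial_state_deriv assms jet_polynomial_input_deriv)
qed

text \<open>In the step from k to k+1 the new entries are u_0, from f, and u_(j+1) with j < k, so
  nothing from index k+1 on is read. This finite dependence later lets a jet known to finite order
  stand in for the jet of a smooth signal.\<close>

lemma output_deriv_cong:
  "(\<And>j. j < k \<Longrightarrow> u j = u' j) \<Longrightarrow> output_deriv f h k x u = output_deriv f h k x u'"
proof (induction k arbitrary: x u u')
  case (Suc k)
  have 1: "output_deriv f h k \<xi> u = output_deriv f h k \<xi> u'" for \<xi>
    using Suc.prems by (intro Suc.IH) auto
  have 2: "output_deriv f h k x (u(j := c)) = output_deriv f h k x (u'(j := c))" for j c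
    using Suc.prems by (intro Suc.IH) auto
  show ?case
    using Suc.prems by (simp add: 1 2)
qed auto

lemma input_deriv_output_deriv_eq_0:
  assumes "k \<le> j"
  shows "input_deriv j (output_deriv f h k) x u = 0"
proof -
  have "output_deriv f h k x (u(j := c)) = output_deriv f h k x u" for c
    using assms by (intro output_deriv_cong) auto
  then show ?thesis by (simp add: input_deriv_def)
qed

text \<open>Each G reads finitely many entries of u, but the class does not record how many. Hence
  the sum is truncated at an arbitrary large M; allowing all M above a threshold lets sums and
  products take the larger of two thresholds.\<close>

lemma jet_polynomial_chain_rule:
  assumes x: "(x has_vector_derivative f (x t) (u t 0)) (at t within I)"
    and u: "\<And>j. ((\<lambda>t. u t j) has_real_derivative u t (Suc j)) (at t within I)"
  shows "jet_polynomial G \<Longrightarrow> \<exists>N. \<forall>M\<ge>N. ((\<lambda>t. G (x t) (u t)) has_real_derivative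
    state_deriv f G (x t) (u t) + (\<Sum>j<M. input_deriv j G (x t) (u t) * u t (Suc j))) (at t within I)"
proof (induction rule: jet_polynomial.induct)
  case (smooth a)
  let ?D = "frechet_derivative a (at (x t, u t 0))"
  have lin: "linear ?D"
    by (rule has_derivative_linear[OF smooth_has_derivative[OF smooth]])
  have "((\<lambda>t. (x t, u t 0)) has_derivative (\<lambda>v. (v *\<^sub>R f (x t) (u t 0), v * u t 1))) (at t within I)"
    using x u[of 0] unfolding has_vector_derivative_def has_field_derivative_def
    by (auto intro!: has_derivative_Pair simp: mult_commute_abs)
  from has_derivative_compose[OF this smooth_has_derivative[OF smooth]]
  have "((\<lambda>t. a (x t, u t 0)) has_derivative
      (\<lambda>v. ?D (v *\<^sub>R f (x t) (u t 0), v * u t 1))) (at t within I)" .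
  moreover have "?D (v *\<^sub>R f (x t) (u t 0), v * u t 1)
      = v * (?D (f (x t) (u t 0), 0) + ?D (0, 1) * u t 1)" for v
  proof -
    have "(v *\<^sub>R f (x t) (u t 0), v * u t 1)
        = v *\<^sub>R ((f (x t) (u t 0), 0) + u t 1 *\<^sub>R (0, 1))" by simp
    then show ?thesis
      by (simp only: linear_add[OF lin] linear_scale[OF lin] real_scaleR_def mult.commute)
  qed
  ultimately have D: "((\<lambda>t. a (x t, u t 0)) has_real_derivative
      (?D (f (x t) (u t 0), 0) + ?D (0, 1) * u t 1)) (at t within I)"
    unfolding has_field_derivative_def by (simp add: mult_commute_abs)
  have "(\<Sum>j<M. (if j = 0 then ?D (0, 1) else 0) * u t (Suc j)) = ?D (0, 1) * u t 1"
    if "M \<ge> 1" for M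
    using that sum.delta'[of "{..<M}" 0 "\<lambda>j. ?D (0, 1) * u t (Suc j)"]
    by (auto simp: if_distribR if_distrib cong: if_cong)
  with D show ?case
    by (intro exI[of _ 1]) (auto simp: state_deriv_simps input_deriv_simps smooth)
next
  case (coordinate i)
  have "(\<Sum>j<M. (if i = j then 1 else 0) * u t (Suc j)) = u t (Suc i)" if "M \<ge> Suc i" for M
    using that by (auto simp: if_distribR if_distrib cong: if_cong)
  then show ?case
    using u[of i] by (intro exI[of _ "Suc i"]) (auto simp: state_deriv_simps input_deriv_simps)
next
  case (add G K)
  then obtain N1 N2 where
    N1: "\<forall>M\<ge>N1. ((\<lambda>t. G (x t) (u t)) has_real_derivative state_deriv f G (x t) (u t)
      + (\<Sum>j<M. input_deriv j G (x t) (u t) * u t (Suc j))) (at t within I)" and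
    N2: "\<forall>M\<ge>N2. ((\<lambda>t. K (x t) (u t)) has_real_derivative state_deriv f K (x t) (u t)
      + (\<Sum>j<M. input_deriv j K (x t) (u t) * u t (Suc j))) (at t within I)"
    by blast
  show ?case
  proof (intro exI[of _ "max N1 N2"] allI impI)
    fix M assume "max N1 N2 \<le> M"
    then show "((\<lambda>t. G (x t) (u t) + K (x t) (u t)) has_real_derivative
        state_deriv f (\<lambda>x u. G x u + K x u) (x t) (u t) +
        (\<Sum>j<M. input_deriv j (\<lambda>x u. G x u + K x u) (x t) (u t) * u t (Suc j))) (at t within I)"
      using DERIV_add[OF N1[rule_format] N2[rule_format], of M M] add.hyps
      by (simp add: state_deriv_simps input_deriv_simps algebra_simps sum.distrib)
  qed
next
  case (mult G K)
  then obtain N1 N2 where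
    N1: "\<forall>M\<ge>N1. ((\<lambda>t. G (x t) (u t)) has_real_derivative state_deriv f G (x t) (u t)
      + (\<Sum>j<M. input_deriv j G (x t) (u t) * u t (Suc j))) (at t within I)" and
    N2: "\<forall>M\<ge>N2. ((\<lambda>t. K (x t) (u t)) has_real_derivative state_deriv f K (x t) (u t)
      + (\<Sum>j<M. input_deriv j K (x t) (u t) * u t (Suc j))) (at t within I)"
    by blast
  show ?case
  proof (intro exI[of _ "max N1 N2"] allI impI)
    fix M assume "max N1 N2 \<le> M"
    then show "((\<lambda>t. G (x t) (u t) * K (x t) (u t)) has_real_derivative
        state_deriv f (\<lambda>x u. G x u * K x u) (x t) (u t) +
        (\<Sum>j<M. input_deriv j (\<lambda>x u. G x u * K x u) (x t) (u t) * u t (Suc j))) (at t within I)"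
      using DERIV_mult[OF N1[rule_format] N2[rule_format], of M M] mult.hyps
      by (simp add: state_deriv_simps input_deriv_simps algebra_simps sum.distrib
          sum_distrib_left sum_distrib_right)
  qed
qed

lemma output_deriv_has_real_derivative:
  assumes f: "smooth (\<lambda>(x, c). f x c)" and h: "smooth h"
    and x: "(x has_vector_derivative f (x t) (u t 0)) (at t within I)"
    and u: "\<And>j. ((\<lambda>t. u t j) has_real_derivative u t (Suc j)) (at t within I)"
  shows "((\<lambda>t. output_deriv f h k (x t) (u t)) has_real_derivative
    output_deriv f h (Suc k) (x t) (u t)) (at t within I)"
proof -
  let ?s = "\<lambda>j. input_deriv j (output_deriv f h k) (x t) (u t) * u t (Suc j)"
  obtain N where N: "\<And>M. M \<ge> N \<Longrightarrow> ((\<lambda>t. output_deriv f h k (x t) (u t)) has_real_derivative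
      state_deriv f (output_deriv f h k) (x t) (u t) + (\<Sum>j<M. ?s j)) (at t within I)"
    using jet_polynomial_chain_rule[of x f t u I, OF x u jet_polynomial_output_deriv[OF f h, of k]] by blast
  \<comment> \<open>The threshold N is unknown, but H_k does not depend on u_j for j \<ge> k, so the
    sum can be cut back to j < k.\<close>
  have "(\<Sum>j<max N k. ?s j) = (\<Sum>j<k. ?s j)"
    by (rule sum.mono_neutral_right) (auto simp: input_deriv_output_deriv_eq_0)
  with N[of "max N k"] show ?thesis
    by (simp only: output_deriv_Suc max.cobounded1)
qed

section \<open>The essential supremum norm\<close>

lemma sup_norm_nonneg: "0 \<le> sup_norm z a b"
  by (simp add: sup_norm_def)

text \<open>No measurability is asked of z, because this is applied to outputs h(x) for an arbitrary
  map h.\<close>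

lemma sup_norm_le:
  assumes "a \<le> b" and "\<And>s. s \<in> {a..b} \<Longrightarrow> norm (z s) \<le> M"
  shows "sup_norm z a b \<le> M"
proof (cases "a = b")
  case True
  then show ?thesis using assms(2)[of a] by (simp add: sup_norm_def)
next
  case False
  let ?M = "lebesgue_on {a..b}" and ?z = "\<lambda>s. ennreal (norm (z s))"
  have "0 \<le> M"
    using order_trans[OF norm_ge_zero assms(2)[of a]] assms(1) by simp
  show ?thesis
  proof (cases "?z \<in> borel_measurable ?M")
    case True
    have "esssup ?M ?z \<le> ennreal M"
      by (rule esssup_I[OF True]) (auto intro!: AE_I2 ennreal_leI assms(2))
    then show ?thesis
      using enn2real_mono[of "esssup ?M ?z" "ennreal M"] \<open>0 \<le> M\<close> False
      by (simp add: sup_norm_def)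
  next
    case nonmeasurable: False
    \<comment> \<open>A non-measurable function has essential supremum \<open>top\<close>, which
      \<open>enn2real\<close> sends to 0.\<close>
    show ?thesis
      using \<open>0 \<le> M\<close> False esssup_non_measurable[OF nonmeasurable] by (simp add: sup_norm_def)
  qed
qed

text \<open>The set where the norm stays below the essential supremum has full measure and is closed
  by continuity. A closed set that is almost all of an open interval contains it, and hence contains
  the closed interval.\<close>

lemma norm_le_sup_norm:
  fixes z :: "real \<Rightarrow> 'a::real_normed_vector"
  assumes cont: "continuous_on {a..b} z" and s: "s \<in> {a..b}"
  shows "norm (z s) \<le> sup_norm z a b"
proof (cases "a = b")
  case True
  then show ?thesis using s by (simp add: sup_norm_def)
next
  case False
  then have "a < b" using s by simp
  let ?M = "lebesgue_on {a..b}" and ?z = "\<lambda>s. ennreal (norm (z s))"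
  have cont': "continuous_on {a..b} (\<lambda>s. norm (z s))"
    by (intro continuous_on_norm cont)
  \<comment> \<open>The essential supremum must first be shown finite, since \<open>enn2real\<close>
    would turn \<open>top\<close> into 0.\<close>
  have "bounded (z ` {a..b})"
    by (intro compact_imp_bounded compact_continuous_image cont compact_Icc)
  then obtain B where B: "\<And>s. s \<in> {a..b} \<Longrightarrow> norm (z s) \<le> B"
    unfolding bounded_iff by blast
  have "(\<lambda>s. norm (z s)) \<in> borel_measurable ?M"
    by (rule continuous_imp_measurable_on_sets_lebesgue[OF cont']) simp
  then have meas: "?z \<in> borel_measurable ?M" by measurable
  have "esssup ?M ?z \<le> ennreal B"
    by (rule esssup_I[OF meas]) (auto intro!: AE_I2 ennreal_leI B)
  then have "esssup ?M ?z < top"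
    using ennreal_less_top order_le_less_trans by blast
  then have esssup: "esssup ?M ?z = ennreal (sup_norm z a b)"
    using False by (simp add: sup_norm_def)
  have "AE s in ?M. norm (z s) \<le> sup_norm z a b"
    using esssup_AE[of ?z ?M] by (simp add: esssup sup_norm_nonneg ennreal_le_iff)
  then have AE: "AE s\<in>{a..b} in lebesgue. norm (z s) \<le> sup_norm z a b"
    by (simp add: AE_restrict_space_iff)
  define C where "C = {s \<in> {a..b}. norm (z s) \<le> sup_norm z a b}"
  have "closed C"
    using continuous_on_closed_Collect_le[OF cont' continuous_on_const] by (simp add: C_def)
  have "s \<in> C" if "s \<in> {a<..<b}" for s
  proof (rule mem_closed_if_AE_lebesgue_open[OF _ \<open>closed C\<close> _ that])
    show "AE s\<in>{a<..<b} in lebesgue. s \<in> C"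
      by (rule eventually_mono[OF AE]) (simp add: C_def)
  qed simp
  then have "closure {a<..<b} \<subseteq> C"
    by (intro closure_minimal \<open>closed C\<close>) auto
  then show ?thesis
    using s \<open>a < b\<close> by (auto simp: C_def)
qed

section \<open>Comparison functions\<close>

lemma class_KD:
  assumes "\<alpha> \<in> class_K"
  shows class_K_continuous_on: "continuous_on {0..} \<alpha>"
    and class_K_0: "\<alpha> 0 = 0"
    and class_K_mono: "0 \<le> s \<Longrightarrow> s \<le> t \<Longrightarrow> \<alpha> s \<le> \<alpha> t"
    and class_K_strict_mono: "0 \<le> s \<Longrightarrow> s < t \<Longrightarrow> \<alpha> s < \<alpha> t"
    and class_K_nonneg: "0 \<le> t \<Longrightarrow> 0 \<le> \<alpha> t"
proof -
  show "continuous_on {0..} \<alpha>" and 0: "\<alpha> 0 = 0"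
    using assms by (auto simp: class_K_def)
  show less: "\<alpha> s < \<alpha> t" if "0 \<le> s" "s < t" for s t
    using assms that by (auto simp: class_K_def strict_mono_on_def)
  show le: "\<alpha> s \<le> \<alpha> t" if "0 \<le> s" "s \<le> t" for s t
    using less[of s t] that by (cases "s = t") auto
  show "0 \<le> \<alpha> t" if "0 \<le> t"
    using le[of 0 t] 0 that by simp
qed

lemma class_K_inf_imp_class_K: "\<alpha> \<in> class_K_inf \<Longrightarrow> \<alpha> \<in> class_K"
  by (simp add: class_K_inf_def)

lemma class_K_add:
  assumes "\<alpha> \<in> class_K" and "\<beta> \<in> class_K"
  shows "(\<lambda>s. \<alpha> s + \<beta> s) \<in> class_K"
  using class_KD[OF assms(1)] class_KD[OF assms(2)]
  by (auto simp: class_K_def strict_mono_on_def intro!: continuous_on_add add_strict_mono)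

lemma class_K_compose:
  assumes "\<alpha> \<in> class_K" and "\<beta> \<in> class_K"
  shows "(\<lambda>s. \<alpha> (\<beta> s)) \<in> class_K"
  using class_KD[OF assms(1)] class_KD[OF assms(2)]
  by (auto simp: class_K_def strict_mono_on_def intro!: continuous_on_compose2[of "{0..}" \<alpha> _ \<beta>])

lemma class_K_mult: "0 < c \<Longrightarrow> (\<lambda>s. c * s) \<in> class_K"
  by (auto simp: class_K_def strict_mono_on_def intro!: continuous_intros)

lemma class_K_ident: "(\<lambda>s. s) \<in> class_K"
  using class_K_mult[of 1] by simp

text \<open>Unboundedness is not tracked through the intermediate estimates; enlarging the final
  gain by the identity restores it.\<close>

lemma class_K_add_ident_class_K_inf:
  assumes "\<alpha> \<in> class_K"
  shows "(\<lambda>s. \<alpha> s + s) \<in> class_K_inf"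
proof -
  have "\<not> bdd_above ((\<lambda>s. \<alpha> s + s) ` {0..})"
  proof
    assume "bdd_above ((\<lambda>s. \<alpha> s + s) ` {0..})"
    then obtain B where B: "\<And>s. 0 \<le> s \<Longrightarrow> \<alpha> s + s \<le> B"
      by (auto simp: bdd_above_def)
    show False
      using B[of "max 0 (B + 1)"] class_K_nonneg[OF assms, of "max 0 (B + 1)"] by auto
  qed
  with class_K_add[OF assms class_K_ident] show ?thesis
    by (simp add: class_K_inf_def)
qed

text \<open>A class K function need not be subadditive, but a + b is at most twice the larger
  summand. This is the origin of the factors 2 in the composed comparison functions.\<close>

lemma class_K_weak_triangle:
  assumes "\<alpha> \<in> class_K" and "0 \<le> a" and "0 \<le> b"
  shows "\<alpha> (a + b) \<le> \<alpha> (2 * a) + \<alpha> (2 * b)"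
proof (cases "a \<le> b")
  case True
  then show ?thesis
    using class_K_mono[OF assms(1), of "a + b" "2 * b"] class_K_nonneg[OF assms(1), of "2 * a"] assms
    by simp
next
  case False
  then show ?thesis
    using class_K_mono[OF assms(1), of "a + b" "2 * a"] class_K_nonneg[OF assms(1), of "2 * b"] assms
    by simp
qed

lemma class_KLD:
  assumes "\<beta> \<in> class_KL"
  shows class_KL_class_K: "0 \<le> t \<Longrightarrow> (\<lambda>s. \<beta> s t) \<in> class_K"
    and class_KL_antimono: "0 \<le> s \<Longrightarrow> 0 \<le> t \<Longrightarrow> t \<le> t' \<Longrightarrow> \<beta> s t' \<le> \<beta> s t"
    and class_KL_tendsto: "0 \<le> s \<Longrightarrow> (\<beta> s \<longlongrightarrow> 0) at_top"
    and class_KL_mono: "0 \<le> s \<Longrightarrow> s \<le> s' \<Longrightarrow> 0 \<le> t \<Longrightarrow> \<beta> s t \<le> \<beta> s' t"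
    and class_KL_nonneg: "0 \<le> s \<Longrightarrow> 0 \<le> t \<Longrightarrow> 0 \<le> \<beta> s t"
  using assms class_K_mono[of "\<lambda>s. \<beta> s t" s s'] class_K_nonneg[of "\<lambda>s. \<beta> s t" s]
  by (auto simp: class_KL_def monotone_on_def)

lemma class_KLI:
  assumes "\<And>t. 0 \<le> t \<Longrightarrow> (\<lambda>s. \<beta> s t) \<in> class_K"
    and "\<And>s t t'. 0 \<le> s \<Longrightarrow> 0 \<le> t \<Longrightarrow> t \<le> t' \<Longrightarrow> \<beta> s t' \<le> \<beta> s t"
    and "\<And>s. 0 \<le> s \<Longrightarrow> (\<beta> s \<longlongrightarrow> 0) at_top"
  shows "\<beta> \<in> class_KL"
  using assms by (auto simp: class_KL_def monotone_on_def)

lemma class_KL_add: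
  assumes "\<beta>1 \<in> class_KL" and "\<beta>2 \<in> class_KL"
  shows "(\<lambda>s t. \<beta>1 s t + \<beta>2 s t) \<in> class_KL"
proof (rule class_KLI)
  show "((\<lambda>t. \<beta>1 s t + \<beta>2 s t) \<longlongrightarrow> 0) at_top" if "0 \<le> s" for s
    using tendsto_add[OF class_KL_tendsto[OF assms(1) that] class_KL_tendsto[OF assms(2) that]]
    by simp
qed (auto intro!: class_K_add class_KL_class_K[OF assms(1)] class_KL_class_K[OF assms(2)]
    add_mono class_KL_antimono[OF assms(1)] class_KL_antimono[OF assms(2)])

text \<open>Provides the terms with a rescaled state and half the time that a restart at t / 2
  produces.\<close>

lemma class_KL_scale_args:
  assumes "\<beta> \<in> class_KL" and "\<alpha> \<in> class_K" and "0 < c"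
  shows "(\<lambda>s t. \<beta> (\<alpha> s) (c * t)) \<in> class_KL"
proof (rule class_KLI)
  show "((\<lambda>t. \<beta> (\<alpha> s) (c * t)) \<longlongrightarrow> 0) at_top" if "0 \<le> s" for s
    by (rule filterlim_compose[OF class_KL_tendsto[OF assms(1) class_K_nonneg[OF assms(2) that]]])
      (intro filterlim_tendsto_pos_mult_at_top[OF tendsto_const assms(3)] filterlim_ident)
  show "(\<lambda>s. \<beta> (\<alpha> s) (c * t)) \<in> class_K" if "0 \<le> t" for t
    using class_K_compose[OF class_KL_class_K[OF assms(1)] assms(2)] assms(3) that by simp
qed (use assms in \<open>auto intro!: class_KL_antimono[OF assms(1)] class_K_nonneg[OF assms(2)]\<close>)

lemma class_K_compose_class_KL:
  assumes "\<alpha> \<in> class_K" and "\<beta> \<in> class_KL"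
  shows "(\<lambda>s t. \<alpha> (\<beta> s t)) \<in> class_KL"
proof (rule class_KLI)
  fix s :: real assume s: "0 \<le> s"
  have "((\<lambda>t. \<alpha> (\<beta> s t)) \<longlongrightarrow> \<alpha> 0) at_top"
    using class_KL_nonneg[OF assms(2) s]
    by (intro continuous_on_tendsto_compose[OF class_K_continuous_on[OF assms(1)]
          class_KL_tendsto[OF assms(2) s]])
      (auto intro: eventually_mono[OF eventually_ge_at_top[of 0]])
  then show "((\<lambda>t. \<alpha> (\<beta> s t)) \<longlongrightarrow> 0) at_top"
    by (simp add: class_K_0[OF assms(1)])
next
  show "(\<lambda>s. \<alpha> (\<beta> s t)) \<in> class_K" if "0 \<le> t" for t
    using class_K_compose[OF assms(1) class_KL_class_K[OF assms(2) that]] .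
  show "\<alpha> (\<beta> s t') \<le> \<alpha> (\<beta> s t)" if "0 \<le> s" "0 \<le> t" "t \<le> t'" for s t t'
    using that by (intro class_K_mono[OF assms(1)] class_KL_antimono[OF assms(2)]
        class_KL_nonneg[OF assms(2)]) auto
qed

section \<open>Domination by a decaying term plus a gain, uniformly over trajectories\<close>

lemma time_interval_nonneg: "t \<in> time_interval T \<Longrightarrow> 0 \<le> t"
  by (simp add: time_interval_def)

lemma time_interval_downward_closed:
  "t' \<in> time_interval T \<Longrightarrow> 0 \<le> t \<Longrightarrow> t \<le> t' \<Longrightarrow> t \<in> time_interval T"
  by (auto simp: time_interval_def elim: order_le_less_trans[rotated])

text \<open>Here i stands for a trajectory on [0, T i), \<open>s i\<close> for the size of its
  initial state and \<open>E i t\<close> for the running supremum of the error signal. Families are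
  considered because a single pair of comparison functions must serve all trajectories.\<close>

locale comparison =
  fixes R :: "'i set" and T :: "'i \<Rightarrow> ereal" and s :: "'i \<Rightarrow> real" and E :: "'i \<Rightarrow> real \<Rightarrow> real"
  assumes s_nonneg: "i \<in> R \<Longrightarrow> 0 \<le> s i"
    and E_nonneg: "i \<in> R \<Longrightarrow> t \<in> time_interval (T i) \<Longrightarrow> 0 \<le> E i t"
    and E_mono: "i \<in> R \<Longrightarrow> t' \<in> time_interval (T i) \<Longrightarrow> 0 \<le> t \<Longrightarrow> t \<le> t' \<Longrightarrow> E i t \<le> E i t'"
begin

definition dominated :: "('i \<Rightarrow> real \<Rightarrow> real) \<Rightarrow> bool" where
  "dominated W \<longleftrightarrow> (\<exists>\<beta>\<in>class_KL. \<exists>\<gamma>\<in>class_K.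
     \<forall>i\<in>R. \<forall>t\<in>time_interval (T i). W i t \<le> \<beta> (s i) t + \<gamma> (E i t))"

lemma dominatedI:
  assumes "\<beta> \<in> class_KL" and "\<gamma> \<in> class_K"
    and "\<And>i t. i \<in> R \<Longrightarrow> t \<in> time_interval (T i) \<Longrightarrow> W i t \<le> \<beta> (s i) t + \<gamma> (E i t)"
  shows "dominated W"
  using assms unfolding dominated_def by blast

lemma dominated_mono:
  assumes "dominated W" and "\<And>i t. i \<in> R \<Longrightarrow> t \<in> time_interval (T i) \<Longrightarrow> V i t \<le> W i t"
  shows "dominated V"
  using assms unfolding dominated_def by (meson order_trans)


text \<open>The identity is of class K, so the gain absorbs an error term. This serves the passage
  from y_q to y = y_q - e_q.\<close>

lemma dominated_le_add_E:
  assumes "dominated W"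
    and "\<And>i t. i \<in> R \<Longrightarrow> t \<in> time_interval (T i) \<Longrightarrow> V i t \<le> W i t + E i t"
  shows "dominated V"
proof -
  obtain \<beta> \<gamma> where "\<beta> \<in> class_KL" "\<gamma> \<in> class_K"
    and W: "\<And>i t. i \<in> R \<Longrightarrow> t \<in> time_interval (T i) \<Longrightarrow> W i t \<le> \<beta> (s i) t + \<gamma> (E i t)"
    using assms(1) unfolding dominated_def by metis
  moreover have "V i t \<le> \<beta> (s i) t + (\<gamma> (E i t) + E i t)"
    if "i \<in> R" "t \<in> time_interval (T i)" for i t
    using W[OF that] assms(2)[OF that] by linarith
  ultimately show ?thesis
    by (intro dominatedI[OF _ class_K_add[OF _ class_K_ident], of \<beta> \<gamma>])
qed

lemma dominated_add:
  assumes "dominated W" and "dominated V"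
  shows "dominated (\<lambda>i t. W i t + V i t)"
proof -
  obtain \<beta>1 \<gamma>1 \<beta>2 \<gamma>2 where "\<beta>1 \<in> class_KL" "\<gamma>1 \<in> class_K" "\<beta>2 \<in> class_KL" "\<gamma>2 \<in> class_K"
    and W: "\<And>i t. i \<in> R \<Longrightarrow> t \<in> time_interval (T i) \<Longrightarrow> W i t \<le> \<beta>1 (s i) t + \<gamma>1 (E i t)"
    and V: "\<And>i t. i \<in> R \<Longrightarrow> t \<in> time_interval (T i) \<Longrightarrow> V i t \<le> \<beta>2 (s i) t + \<gamma>2 (E i t)"
    using assms unfolding dominated_def by metis
  then show ?thesis
    using add_mono[OF W V]
    by (intro dominatedI[OF class_KL_add[of \<beta>1 \<beta>2] class_K_add[of \<gamma>1 \<gamma>2]])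
      (auto simp: algebra_simps)
qed

lemma dominated_class_K:
  assumes "dominated W" and "\<alpha> \<in> class_K"
    and W: "\<And>i t. i \<in> R \<Longrightarrow> t \<in> time_interval (T i) \<Longrightarrow> 0 \<le> W i t"
  shows "dominated (\<lambda>i t. \<alpha> (W i t))"
proof -
  obtain \<beta> \<gamma> where \<beta>: "\<beta> \<in> class_KL" and \<gamma>: "\<gamma> \<in> class_K"
    and le: "\<And>i t. i \<in> R \<Longrightarrow> t \<in> time_interval (T i) \<Longrightarrow> W i t \<le> \<beta> (s i) t + \<gamma> (E i t)"
    using assms(1) unfolding dominated_def by metis
  have *: "(\<lambda>s. \<alpha> (2 * s)) \<in> class_K"
    using class_K_compose[OF assms(2) class_K_mult[of 2]] by simp
  show ?thesis
  proof (rule dominatedI[OF class_K_compose_class_KL[OF * \<beta>] class_K_compose[OF * \<gamma>]])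
    fix i t assume i: "i \<in> R" "t \<in> time_interval (T i)"
    then have "0 \<le> t" by (simp add: time_interval_def)
    have "\<alpha> (W i t) \<le> \<alpha> (\<beta> (s i) t + \<gamma> (E i t))"
      by (rule class_K_mono[OF assms(2) W[OF i] le[OF i]])
    also have "\<dots> \<le> \<alpha> (2 * \<beta> (s i) t) + \<alpha> (2 * \<gamma> (E i t))"
      by (rule class_K_weak_triangle[OF assms(2) class_KL_nonneg[OF \<beta> s_nonneg[OF i(1)] \<open>0 \<le> t\<close>]
            class_K_nonneg[OF \<gamma> E_nonneg[OF i]]])
    finally show "\<alpha> (W i t) \<le> \<alpha> (2 * \<beta> (s i) t) + \<alpha> (2 * \<gamma> (E i t))" .
  qed
qed

text \<open>Restarting at \<open>t / 2\<close>: up to that time the state is bounded by a function of \<open>s i\<close> and the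
  supremum \<open>E\<close>, which the second half of the interval turns into a decaying term, while on the
  second half the driving signal \<open>W\<close> has itself decayed.\<close>

lemma dominated_cascade:
  assumes W: "dominated W" and \<beta>: "\<beta> \<in> class_KL" and \<gamma>: "\<gamma> \<in> class_K"
    and restart: "\<And>i t0 t1 M. i \<in> R \<Longrightarrow> 0 \<le> t0 \<Longrightarrow> t0 \<le> t1 \<Longrightarrow> t1 \<in> time_interval (T i) \<Longrightarrow>
      (\<And>\<tau>. \<tau> \<in> {t0..t1} \<Longrightarrow> W i \<tau> \<le> M) \<Longrightarrow> X i t1 \<le> \<beta> (X i t0) (t1 - t0) + \<gamma> M"
    and s: "\<And>i. i \<in> R \<Longrightarrow> X i 0 \<le> s i"
    and X: "\<And>i t. i \<in> R \<Longrightarrow> t \<in> time_interval (T i) \<Longrightarrow> 0 \<le> X i t"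
  shows "dominated X"
proof -
  obtain \<beta>W \<gamma>W where \<beta>W: "\<beta>W \<in> class_KL" and \<gamma>W: "\<gamma>W \<in> class_K"
    and W: "\<And>i t. i \<in> R \<Longrightarrow> t \<in> time_interval (T i) \<Longrightarrow> W i t \<le> \<beta>W (s i) t + \<gamma>W (E i t)"
    using W unfolding dominated_def by metis
  \<comment> \<open>The factor 2 comes from \<open>class_K_weak_triangle\<close>, as W is bounded by
    a sum. In the bound on X at t / 2, \<open>a\<close> collects the part due to the initial state
    and \<open>g\<close> the part due to E. Over the second half only the part with \<open>a\<close>
    has to decay; the part with \<open>g\<close> is evaluated at time 0 and joins the gain.\<close>
  define \<gamma>' where "\<gamma>' = (\<lambda>s. \<gamma> (2 * s))"
  define a where "a = (\<lambda>s. \<beta> s 0 + \<gamma>' (\<beta>W s 0))"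
  define g where "g = (\<lambda>s. \<gamma>' (\<gamma>W s))"
  define \<beta>X where "\<beta>X = (\<lambda>s t. \<beta> (2 * a s) (1 / 2 * t) + \<gamma>' (\<beta>W s (1 / 2 * t)))"
  define \<gamma>X where "\<gamma>X = (\<lambda>s. \<beta> (2 * g s) 0 + \<gamma>' (\<gamma>W s))"
  have \<gamma>': "\<gamma>' \<in> class_K"
    unfolding \<gamma>'_def using class_K_compose[OF \<gamma> class_K_mult[of 2]] by simp
  have a: "a \<in> class_K"
    unfolding a_def
    by (rule class_K_add[OF class_KL_class_K[OF \<beta>] class_K_compose[OF \<gamma>' class_KL_class_K[OF \<beta>W]]]) auto
  have g: "g \<in> class_K"
    unfolding g_def by (rule class_K_compose[OF \<gamma>' \<gamma>W])
  have "(\<lambda>s t. \<beta> (2 * a s) (1 / 2 * t)) \<in> class_KL"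
    by (rule class_KL_scale_args[OF \<beta> class_K_compose[OF class_K_mult a]]) auto
  moreover have "(\<lambda>s t. \<gamma>' (\<beta>W s (1 / 2 * t))) \<in> class_KL"
    by (rule class_K_compose_class_KL[OF \<gamma>' class_KL_scale_args[OF \<beta>W class_K_ident]]) auto
  ultimately have \<beta>X: "\<beta>X \<in> class_KL"
    unfolding \<beta>X_def by (rule class_KL_add)
  have "(\<lambda>s. \<beta> (2 * g s) 0) \<in> class_K"
    using class_K_compose[OF class_KL_class_K[OF \<beta>] class_K_compose[OF class_K_mult[of 2] g]] by simp
  then have \<gamma>X: "\<gamma>X \<in> class_K"
    unfolding \<gamma>X_def by (rule class_K_add[OF _ class_K_compose[OF \<gamma>' \<gamma>W]])
  show ?thesis
  proof (rule dominatedI[OF \<beta>X \<gamma>X])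
    fix i t assume i: "i \<in> R" and t: "t \<in> time_interval (T i)"
    have t0: "0 \<le> t" using time_interval_nonneg[OF t] .
    have t2: "t / 2 \<in> time_interval (T i)" and D0: "0 \<in> time_interval (T i)"
      using time_interval_downward_closed[OF t] t0 by auto
    have s0: "0 \<le> s i"
      using X[OF i D0] s[OF i] by linarith
    have E2: "0 \<le> E i (t / 2)" "E i (t / 2) \<le> E i t"
      using E_nonneg[OF i t2] E_mono[OF i t, of "t / 2"] t0 by auto
    have Et: "0 \<le> E i t" using E2 by linarith
    have step: "X i t1 \<le> \<beta> (X i t0) (t1 - t0) + (\<gamma>' (\<beta>W (s i) t0) + \<gamma>' (\<gamma>W (E i t1)))"
      if "0 \<le> t0" "t0 \<le> t1" "t1 \<in> time_interval (T i)" for t0 t1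
    proof -
      \<comment> \<open>On [t0, t1] the decaying part of the bound on W is largest at t0 and the
        gain part at t1.\<close>
      have "W i \<tau> \<le> \<beta>W (s i) t0 + \<gamma>W (E i t1)" if \<tau>: "\<tau> \<in> {t0..t1}" for \<tau>
      proof -
        have "0 \<le> \<tau>" "\<tau> \<le> t1" "t0 \<le> \<tau>" using \<tau> \<open>0 \<le> t0\<close> by auto
        note \<tau>D = time_interval_downward_closed[OF \<open>t1 \<in> time_interval (T i)\<close> this(1,2)]
        show ?thesis
          using W[OF i \<tau>D] class_KL_antimono[OF \<beta>W s0 \<open>0 \<le> t0\<close> \<open>t0 \<le> \<tau>\<close>]
            class_K_mono[OF \<gamma>W E_nonneg[OF i \<tau>D] E_mono[OF i \<open>t1 \<in> time_interval (T i)\<close> \<open>0 \<le> \<tau>\<close> \<open>\<tau> \<le> t1\<close>]] by linarith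
      qed
      from restart[OF i that this] show ?thesis
        using class_K_weak_triangle[OF \<gamma> class_KL_nonneg[OF \<beta>W s0 \<open>0 \<le> t0\<close>]
            class_K_nonneg[OF \<gamma>W E_nonneg[OF i \<open>t1 \<in> time_interval (T i)\<close>]]]
        by (simp add: \<gamma>'_def)
    qed
    have half: "X i (t / 2) \<le> a (s i) + g (E i t)"
    proof -
      have "X i (t / 2) \<le> \<beta> (X i 0) (t / 2) + (\<gamma>' (\<beta>W (s i) 0) + \<gamma>' (\<gamma>W (E i (t / 2))))"
        using step[of 0 "t / 2"] t0 t2 by simp
      also have "\<beta> (X i 0) (t / 2) \<le> \<beta> (X i 0) 0"
        by (rule class_KL_antimono[OF \<beta> X[OF i D0]]) (use t0 in auto)
      also have "\<beta> (X i 0) 0 \<le> \<beta> (s i) 0"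
        by (rule class_KL_mono[OF \<beta> X[OF i D0] s[OF i]]) simp
      also have "\<gamma>' (\<gamma>W (E i (t / 2))) \<le> \<gamma>' (\<gamma>W (E i t))"
        by (intro class_K_mono[OF \<gamma>'] class_K_mono[OF \<gamma>W] class_K_nonneg[OF \<gamma>W] E2)
      finally show ?thesis by (simp add: a_def g_def)
    qed
    have "X i t \<le> \<beta> (X i (t / 2)) (t / 2) + (\<gamma>' (\<beta>W (s i) (t / 2)) + \<gamma>' (\<gamma>W (E i t)))"
      using step[of "t / 2" t] t0 t by simp
    also have "\<beta> (X i (t / 2)) (t / 2) \<le> \<beta> (a (s i) + g (E i t)) (t / 2)"
      by (rule class_KL_mono[OF \<beta> X[OF i t2] half]) (use t0 in auto)
    also have "\<dots> \<le> \<beta> (2 * a (s i)) (t / 2) + \<beta> (2 * g (E i t)) (t / 2)"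
      by (rule class_K_weak_triangle[OF class_KL_class_K[OF \<beta>]])
        (use t0 class_K_nonneg[OF a s0] class_K_nonneg[OF g Et] in auto)
    also have "\<beta> (2 * g (E i t)) (t / 2) \<le> \<beta> (2 * g (E i t)) 0"
      by (rule class_KL_antimono[OF \<beta>]) (use t0 class_K_nonneg[OF g Et] in auto)
    finally show "X i t \<le> \<beta>X (s i) t + \<gamma>X (E i t)"
      by (simp add: \<beta>X_def \<gamma>X_def)
  qed
qed

end

section \<open>Smooth signals\<close>

text \<open>Derivatives within I are unique only at limit points of I. An interval with two distinct
  points is connected and not a singleton, so it has no isolated points.\<close>

lemma at_within_interval_ne_bot:
  fixes I :: "real set"
  assumes "is_interval I" and "a \<in> I" "b \<in> I" "a \<noteq> b" and "t \<in> I"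
  shows "at t within I \<noteq> bot"
proof -
  have "t islimpt I"
    by (rule connected_imp_perfect)
      (use assms in \<open>auto simp: is_interval_connected_1\<close>)
  then show ?thesis by (simp add: trivial_limit_within)
qed

text \<open>Solutions live on half-open intervals; the later time gives one, [0, t1), that still
  contains t while its closure stays inside the interval of existence.\<close>

lemma ereal_less_time_interval:
  assumes "t \<in> time_interval T"
  obtains t1 where "t < t1" and "ereal t1 < T" and "t1 \<in> time_interval T"
proof -
  obtain t1 where "ereal t < ereal t1" "ereal t1 < T"
    using assms ereal_dense2[of "ereal t" T] by (auto simp: time_interval_def)
  then show ?thesis
    using that[of t1] assms by (auto simp: time_interval_def)
qed

lemma Icc_subset_time_interval: "0 \<le> a \<Longrightarrow> b \<in> time_interval T \<Longrightarrow> {a..b} \<subseteq> time_interval T"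
  by (auto intro: time_interval_downward_closed)

lemma at_within_time_interval_ne_bot:
  assumes "t \<in> time_interval T"
  shows "at t within time_interval T \<noteq> bot"
proof -
  obtain t1 where "t < t1" "t1 \<in> time_interval T"
    using ereal_less_time_interval[OF assms] by metis
  moreover have "is_interval (time_interval T)"
    unfolding is_interval_1
    by (blast intro: time_interval_downward_closed dest: time_interval_nonneg order_trans)
  ultimately show ?thesis
    using at_within_interval_ne_bot[OF _ assms, of t1 t] assms by simp
qed

text \<open>\<open>nth_deriv\<close> is built from a choice-valued derivative. By uniqueness, it
  agrees with any chain w of successive derivatives that starts at the signal.\<close>

lemma nth_deriv_eqI:
  assumes ne: "\<And>t. t \<in> I \<Longrightarrow> at t within I \<noteq> bot"
    and w: "\<And>j t. j < n \<Longrightarrow> t \<in> I \<Longrightarrow> (w j has_vector_derivative w (Suc j) t) (at t within I)"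
  shows "k \<le> n \<Longrightarrow> t \<in> I \<Longrightarrow> nth_deriv I (w 0) k t = w k t"
proof (induction k arbitrary: t)
  case (Suc k)
  have "(nth_deriv I (w 0) k has_vector_derivative w (Suc k) t) (at t within I)"
    by (rule has_vector_derivative_transform[OF Suc.prems(2) _ w]) (use Suc in auto)
  then show ?case
    using vector_derivative_within[OF ne[OF Suc.prems(2)]] by simp
qed simp

text \<open>Each derivative is linked to the next by an explicit derivative statement, which is the
  form in which the chain rule takes the entries of a jet.\<close>

definition smooth_signal :: "real set \<Rightarrow> (real \<Rightarrow> real) \<Rightarrow> bool" where
  "smooth_signal I z \<longleftrightarrow> (\<forall>k. \<forall>t\<in>I.
     (nth_deriv I z k has_vector_derivative nth_deriv I z (Suc k) t) (at t within I))"

lemma smooth_signalI: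
  assumes ne: "\<And>t. t \<in> I \<Longrightarrow> at t within I \<noteq> bot"
    and w: "\<And>j t. t \<in> I \<Longrightarrow> (w j has_vector_derivative w (Suc j) t) (at t within I)"
  shows "smooth_signal I (w 0)" and "t \<in> I \<Longrightarrow> nth_deriv I (w 0) k t = w k t"
proof -
  show eq: "nth_deriv I (w 0) k t = w k t" if "t \<in> I" for t k
    by (rule nth_deriv_eqI[where w = w and n = k, OF ne w order_refl that])
  show "smooth_signal I (w 0)"
    unfolding smooth_signal_def
  proof (intro allI ballI)
    fix k t assume t: "t \<in> I"
    show "(nth_deriv I (w 0) k has_vector_derivative nth_deriv I (w 0) (Suc k) t) (at t within I)"
      unfolding eq[OF t]
      by (rule has_vector_derivative_transform[OF t _ w[OF t]]) (simp add: eq)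
  qed
qed

lemma smooth_signal_continuous_on: "smooth_signal I z \<Longrightarrow> continuous_on I (nth_deriv I z k)"
  unfolding smooth_signal_def continuous_on_eq_continuous_within
  using has_vector_derivative_continuous by blast

text \<open>By the chain rule, the values of H_k at x(t) and the jet of v form a chain of successive
  derivatives starting at h(x(t)); uniqueness identifies them with the iterated derivatives of the
  output.\<close>

lemma smooth_signal_output:
  assumes f: "smooth (\<lambda>(x, c). f x c)" and h: "smooth h"
    and ne: "\<And>t. t \<in> I \<Longrightarrow> at t within I \<noteq> bot"
    and v: "smooth_signal I v"
    and x: "\<And>t. t \<in> I \<Longrightarrow> (x has_vector_derivative f (x t) (v t)) (at t within I)"
  shows "smooth_signal I (\<lambda>t. h (x t))"
    and "t \<in> I \<Longrightarrow> nth_deriv I (\<lambda>t. h (x t)) k t = output_deriv f h k (x t) (jet I v t)"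
proof -
  have w: "((\<lambda>t. output_deriv f h k (x t) (jet I v t)) has_vector_derivative
      output_deriv f h (Suc k) (x t) (jet I v t)) (at t within I)" if "t \<in> I" for k t
    unfolding has_real_derivative_iff_has_vector_derivative[symmetric]
  proof (rule output_deriv_has_real_derivative[OF f h])
    show "(x has_vector_derivative f (x t) (jet I v t 0)) (at t within I)"
      using x[OF that] by (simp add: jet_def)
    show "((\<lambda>t. jet I v t j) has_real_derivative jet I v t (Suc j)) (at t within I)" for j
      using v that unfolding has_real_derivative_iff_has_vector_derivative smooth_signal_def jet_def
      by blast
  qed
  note s = smooth_signalI[where w = "\<lambda>k t. output_deriv f h k (x t) (jet I v t)" and I = I, OF ne w]
  show "smooth_signal I (\<lambda>t. h (x t))"
    using s(1) by simp
  show "t \<in> I \<Longrightarrow> nth_deriv I (\<lambda>t. h (x t)) k t = output_deriv f h k (x t) (jet I v t)"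
    using s(2)[of t k] by simp
qed

lemma smooth_signal_0:
  assumes "\<And>t. t \<in> I \<Longrightarrow> at t within I \<noteq> bot"
  shows "smooth_signal I (\<lambda>t. 0)"
  using smooth_signalI(1)[where w = "\<lambda>k t. 0" and I = I] assms by simp

text \<open>The system is read as one with dummy input 0. In the closed loop each subsystem is
  driven by outputs of the others, so smoothness cannot be passed from one to the next; the loop as
  a whole has no input.\<close>

lemma smooth_signal_autonomous:
  assumes F: "smooth F" and g: "smooth g"
    and ne: "\<And>t. t \<in> I \<Longrightarrow> at t within I \<noteq> bot"
    and x: "\<And>t. t \<in> I \<Longrightarrow> (x has_vector_derivative F (x t)) (at t within I)"
  shows "smooth_signal I (\<lambda>t. g (x t))"
proof (rule smooth_signal_output(1)[OF _ g ne smooth_signal_0[OF ne]])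
  show "smooth (\<lambda>(x, c::real). F x)"
    unfolding case_prod_unfold by (intro smooth_compose[OF F] smooth_intros)
qed (use x in auto)

lemma nth_deriv_diff:
  assumes ne: "\<And>t. t \<in> I \<Longrightarrow> at t within I \<noteq> bot"
    and z: "smooth_signal I y" "smooth_signal I z" and "t \<in> I"
  shows "nth_deriv I (\<lambda>t. y t - z t) k t = nth_deriv I y k t - nth_deriv I z k t"
proof -
  have "((\<lambda>t. nth_deriv I y j t - nth_deriv I z j t) has_vector_derivative
      nth_deriv I y (Suc j) t - nth_deriv I z (Suc j) t) (at t within I)" if "t \<in> I" for j t
    using z that unfolding smooth_signal_def by (blast intro: has_vector_derivative_diff)
  from smooth_signalI(2)[where w = "\<lambda>j t. nth_deriv I y j t - nth_deriv I z j t", OF ne this \<open>t \<in> I\<close>, of k]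
  show ?thesis by simp
qed

text \<open>Stability of the injected system is assumed for inputs on the whole half-line, whereas the error
  signal of the closed loop lives on the interval of existence only.\<close>

lemma C_extension:
  fixes d :: "nat \<Rightarrow> real \<Rightarrow> real"
  assumes "0 \<le> b"
    and "\<And>j t. j < n \<Longrightarrow> t \<in> {0..b} \<Longrightarrow> (d j has_vector_derivative d (Suc j) t) (at t within {0..b})"
    and "continuous_on {0..b} (d n)"
  shows "\<exists>w. (\<forall>j\<le>n. \<forall>t\<in>{0..b}. w j t = d j t) \<and>
    (\<forall>j<n. \<forall>t\<ge>0. (w j has_vector_derivative w (Suc j) t) (at t within {0..})) \<and>
    continuous_on {0..} (w n) \<and> continuous_on {0..} (w (0::nat))"
  using assms(2,3)
proof (induction n arbitrary: d)
  case 0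
  \<comment> \<open>At order 0 the value at b is held constant beyond b.\<close>
  have "continuous_on {0..} (\<lambda>t. d 0 (min t b))"
    by (rule continuous_on_compose2[OF 0(2)]) (use \<open>0 \<le> b\<close> in \<open>auto intro!: continuous_intros\<close>)
  then show ?case
    by (intro exI[of _ "\<lambda>_ t. d 0 (min t b)"]) simp
next
  case (Suc n)
  have "\<exists>w. (\<forall>j\<le>n. \<forall>t\<in>{0..b}. w j t = d (Suc j) t) \<and>
    (\<forall>j<n. \<forall>t\<ge>0. (w j has_vector_derivative w (Suc j) t) (at t within {0..})) \<and>
    continuous_on {0..} (w n) \<and> continuous_on {0..} (w 0)"
    by (rule Suc.IH) (use Suc.prems in auto)
  then obtain w where w: "\<forall>j\<le>n. \<forall>t\<in>{0..b}. w j t = d (Suc j) t"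
    "\<forall>j<n. \<forall>t\<ge>0. (w j has_vector_derivative w (Suc j) t) (at t within {0..})"
    "continuous_on {0..} (w n)" "continuous_on {0..} (w 0)"
    by blast
  \<comment> \<open>The derivative is extended first and then integrated back. Continuity of
    \<open>w 0\<close> is carried through the induction to make this integral
    differentiable.\<close>
  define w0 where "w0 t = d 0 0 + integral {0..t} (w 0)" for t
  have w0: "(w0 has_vector_derivative w 0 t) (at t within {0..})" if "0 \<le> t" for t
  proof -
    have "((\<lambda>t. integral {0..t} (w 0)) has_vector_derivative w 0 t) (at t within {0..t + 1})"
      using that continuous_on_subset[OF w(4)]
      by (intro integral_has_vector_derivative) auto
    then have "(w0 has_vector_derivative w 0 t) (at t within {0..t + 1})"
      unfolding w0_def by (auto intro!: derivative_eq_intros)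
    moreover have "at t within {0..t + 1} = at t within {0..}"
      by (rule at_within_nhd[of _ "{..<t + 1}"]) auto
    ultimately show ?thesis by simp
  qed
  have eq: "w0 t = d 0 t" if t: "t \<in> {0..b}" for t
  proof -
    have "(d (Suc 0) has_integral d 0 t - d 0 0) {0..t}"
    proof (rule fundamental_theorem_of_calculus)
      show "(d 0 has_vector_derivative d (Suc 0) \<tau>) (at \<tau> within {0..t})" if "\<tau> \<in> {0..t}" for \<tau>
        by (rule has_vector_derivative_within_subset[OF Suc.prems(1)]) (use t that in auto)
    qed (use t in simp)
    then have "(w 0 has_integral d 0 t - d 0 0) {0..t}"
      by (rule has_integral_eq[rotated]) (use w(1) t in auto)
    then show ?thesis by (simp add: w0_def integral_unique)
  qed
  have "continuous_on {0..} w0"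
    unfolding continuous_on_eq_continuous_within
    using has_vector_derivative_continuous[OF w0] by auto
  then show ?case
    using w eq w0
    by (intro exI[of _ "\<lambda>j. case j of 0 \<Rightarrow> w0 | Suc j \<Rightarrow> w j"]) (auto split: nat.split)
qed

lemma smooth_signal_extension:
  assumes z: "smooth_signal (time_interval T) z" and b: "b \<in> time_interval T"
  obtains w where "w \<in> C_on n {0..}"
    and "\<And>k t. k \<le> n \<Longrightarrow> t \<in> {0..b} \<Longrightarrow> jet {0..} w t k = jet (time_interval T) z t k"
proof -
  let ?d = "nth_deriv (time_interval T) z"
  have sub: "{0..b} \<subseteq> time_interval T"
    by (rule Icc_subset_time_interval[OF order_refl b])
  have "\<exists>w. (\<forall>j\<le>n. \<forall>t\<in>{0..b}. w j t = ?d j t) \<and>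
    (\<forall>j<n. \<forall>t\<ge>0. (w j has_vector_derivative w (Suc j) t) (at t within {0..})) \<and>
    continuous_on {0..} (w n) \<and> continuous_on {0..} (w (0::nat))"
  proof (rule C_extension)
    show "(?d j has_vector_derivative ?d (Suc j) t) (at t within {0..b})" if "t \<in> {0..b}" for j t
      using z that sub unfolding smooth_signal_def
      by (blast intro: has_vector_derivative_within_subset)
    show "continuous_on {0..b} (?d n)"
      by (rule continuous_on_subset[OF smooth_signal_continuous_on[OF z] sub])
  qed (rule time_interval_nonneg[OF b])
  then obtain w where w0: "\<forall>j\<le>n. \<forall>t\<in>{0..b}. w j t = ?d j t"
    "\<forall>j<n. \<forall>t\<ge>0. (w j has_vector_derivative w (Suc j) t) (at t within {0..})"
    and w_cont: "continuous_on {0..} (w n)"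
    by blast
  have w: "w j t = ?d j t" if "j \<le> n" "t \<in> {0..b}" for j t
    using w0(1) that by blast
  have w': "(w j has_vector_derivative w (Suc j) t) (at t within {0..})" if "j < n" "t \<in> {0..}" for j t
    using w0(2) that by auto
  have ne: "at t within {0..} \<noteq> bot" if "t \<in> {0..}" for t :: real
    by (rule at_within_interval_ne_bot[OF is_interval_ci, of 0 _ 1]) (use that in auto)
  have eq: "nth_deriv {0..} (w 0) k t = w k t" if "k \<le> n" "t \<in> {0..}" for k t
    by (rule nth_deriv_eqI[where w = w and n = n, OF ne w' that])
  have "nth_deriv {0..} (w 0) k differentiable (at t within {0..})" if "k < n" "t \<in> {0..}" for k t
  proof -
    have "(nth_deriv {0..} (w 0) k has_vector_derivative w (Suc k) t) (at t within {0..})"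
      by (rule has_vector_derivative_transform[OF that(2) _ w'[OF that]]) (use eq that in auto)
    then show ?thesis by (rule differentiableI_vector)
  qed
  moreover have "continuous_on {0..} (nth_deriv {0..} (w 0) n)"
    by (subst continuous_on_cong[OF refl eq[OF order_refl]]) (use w_cont in auto)
  ultimately show ?thesis
    using eq w by (intro that[of "w 0"]) (auto simp: C_on_def jet_def)
qed

text \<open>If r < r', then H_r would not depend on the input, and the inequality for r would bound
  |u_0| at a fixed state by a constant. The result is needed because
  \<open>strongly_minimum_phase\<close> comes with a relative degree of its own, to be identified
  with the given one.\<close>

lemma relative_degree_unique:
  fixes f :: "'x::euclidean_space \<Rightarrow> real \<Rightarrow> 'x"
  assumes r: "relative_degree f h r" and r': "relative_degree f h r'"
  shows "r = r'"
proof -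
  have False if r: "relative_degree f h r" and r': "relative_degree f h r'" and "r < r'" for r r'
  proof -
    obtain \<rho>1 \<rho>2 where *: "\<And>x u. \<bar>u 0\<bar> \<le> \<rho>1 (norm x) + \<rho>2 \<bar>output_deriv f h r x u\<bar>"
      using r unfolding relative_degree_def by blast
    let ?B = "\<rho>1 (norm (0::'x)) + \<rho>2 \<bar>output_deriv f h r 0 (\<lambda>_. 0)\<bar>"
    have "output_deriv f h r 0 (\<lambda>_. \<bar>?B\<bar> + 1) = output_deriv f h r 0 (\<lambda>_. 0)"
      using r' \<open>r < r'\<close> unfolding relative_degree_def by blast
    with *[of "\<lambda>_. \<bar>?B\<bar> + 1" 0] show False by simp
  qed
  then show ?thesis
    using r r' by (metis linorder_neqE_nat)
qed

section \<open>Estimates for states\<close>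

text \<open>Closed-loop trajectories are classical, while the hypotheses quantify over solutions in
  integral form.\<close>

lemma solutionI:
  assumes "0 < T"
    and x: "\<And>t. t \<in> time_interval T \<Longrightarrow>
      (x has_vector_derivative f (x t) (v t)) (at t within time_interval T)"
  shows "solution f v T x"
  unfolding solution_def
proof (intro conjI ballI)
  show "continuous_on (time_interval T) x"
    unfolding continuous_on_eq_continuous_within
    using has_vector_derivative_continuous[OF x] by auto
next
  fix t assume t: "t \<in> time_interval T"
  show "((\<lambda>s. f (x s) (v s)) has_integral x t - x 0) {0..t}"
    using Icc_subset_time_interval[OF order_refl t] x
    by (intro fundamental_theorem_of_calculus time_interval_nonneg[OF t])
      (blast intro: has_vector_derivative_within_subset)
qed (rule assms)

lemma continuous_imp_inputs:
  assumes "continuous_on {0..} v"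
  shows "v \<in> inputs"
proof -
  have "\<exists>B. AE s in lebesgue_on {0..t}. norm (v s) \<le> B" for t
  proof -
    have "bounded (v ` {0..t})"
      using continuous_on_subset[OF assms, of "{0..t}"]
      by (intro compact_imp_bounded compact_continuous_image compact_Icc) auto
    then obtain B where "\<And>s. s \<in> {0..t} \<Longrightarrow> norm (v s) \<le> B"
      unfolding bounded_iff by blast
    then show ?thesis by (intro exI[of _ B] AE_I2) auto
  qed
  then show ?thesis
    using continuous_imp_measurable_on_sets_lebesgue[OF assms] by (simp add: inputs_def)
qed

text \<open>The dynamics are time-invariant, so a tail of a trajectory is again a solution started
  at 0. Its input is frozen from some t1 > t on, which makes it a continuous signal on the half-line
  and leaves it unchanged up to t.\<close>

lemma solution_restart:
  assumes x: "\<And>t. t \<in> time_interval T \<Longrightarrow>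
      (x has_vector_derivative f (x t) (v t)) (at t within time_interval T)"
    and v: "continuous_on (time_interval T) v"
    and "0 \<le> t0" "t0 \<le> t" "t \<in> time_interval T"
  obtains v' T' where "v' \<in> inputs" and "solution f v' T' (\<lambda>s. x (t0 + s))"
    and "t - t0 \<in> time_interval T'" and "\<And>s. s \<in> {0..t - t0} \<Longrightarrow> v' s = v (t0 + s)"
proof -
  obtain t1 where t1: "t < t1" "t1 \<in> time_interval T"
    using ereal_less_time_interval[OF assms(5)] by metis
  have sub: "{t0..t1} \<subseteq> time_interval T"
    by (rule Icc_subset_time_interval[OF assms(3) t1(2)])
  define v' where "v' = (\<lambda>s. v (min (t0 + s) t1))"
  define T' where "T' = ereal (t1 - t0)"
  have mem: "s \<in> time_interval T' \<longleftrightarrow> 0 \<le> s \<and> s < t1 - t0" for s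
    by (simp add: T'_def time_interval_def)
  show ?thesis
  proof (rule that)
    have "continuous_on {0..} v'"
      unfolding v'_def
      by (rule continuous_on_compose2[OF continuous_on_subset[OF v sub]])
        (use assms(3,4) t1 in \<open>auto intro!: continuous_intros\<close>)
    then show "v' \<in> inputs" by (rule continuous_imp_inputs)
    show "solution f v' T' (\<lambda>s. x (t0 + s))"
    proof (rule solutionI)
      show "0 < T'" using assms(4) t1 by (simp add: T'_def)
      fix s assume s: "s \<in> time_interval T'"
      then have "t0 + s \<in> {t0..t1}" by (simp add: mem)
      then have "(x has_vector_derivative f (x (t0 + s)) (v (t0 + s)))
          (at (t0 + s) within (+) t0 ` time_interval T')"
        using sub by (intro has_vector_derivative_within_subset[OF x]) (auto simp: mem)
      moreover have "((+) t0 has_vector_derivative 1) (at s within time_interval T')"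
        by (auto intro!: derivative_eq_intros)
      moreover have "v' s = v (t0 + s)"
        using s by (simp add: v'_def mem)
      ultimately show "((\<lambda>s. x (t0 + s)) has_vector_derivative f (x (t0 + s)) (v' s))
          (at s within time_interval T')"
        using vector_diff_chain_within[of "(+) t0" 1 s "time_interval T'" x] by (simp add: o_def)
    qed
    show "t - t0 \<in> time_interval T'"
      using assms(4) t1 by (simp add: mem)
    show "v' s = v (t0 + s)" if "s \<in> {0..t - t0}" for s
      using that t1 by (simp add: v'_def)
  qed
qed

context comparison
begin

text \<open>Common to the minimum-phase and the detectability estimates, with w the driving signal.
  The bound M is pointwise, so the time shift acts on values and never on essential suprema.\<close>

lemma dominated_state:
  fixes X :: "'i \<Rightarrow> real \<Rightarrow> 'x::euclidean_space" and V :: "'i \<Rightarrow> real \<Rightarrow> 'v::euclidean_space"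
  assumes \<beta>: "\<beta> \<in> class_KL" and \<gamma>: "\<gamma> \<in> class_K"
    and estimate: "\<And>v T x t M. v \<in> inputs \<Longrightarrow> solution f v T x \<Longrightarrow> t \<in> time_interval T \<Longrightarrow>
      (\<And>\<tau>. \<tau> \<in> {0..t} \<Longrightarrow> w (x \<tau>) (v \<tau>) \<le> M) \<Longrightarrow> norm (x t) \<le> \<beta> (norm (x 0)) t + \<gamma> M"
    and X: "\<And>i t. i \<in> R \<Longrightarrow> t \<in> time_interval (T i) \<Longrightarrow>
      (X i has_vector_derivative f (X i t) (V i t)) (at t within time_interval (T i))"
    and V: "\<And>i. i \<in> R \<Longrightarrow> continuous_on (time_interval (T i)) (V i)"
    and W: "dominated (\<lambda>i t. w (X i t) (V i t))"
    and X0: "\<And>i. i \<in> R \<Longrightarrow> norm (X i 0) \<le> s i"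
  shows "dominated (\<lambda>i t. norm (X i t))"
proof (rule dominated_cascade[OF W \<beta> \<gamma>])
  fix i t0 t1 M
  assume i: "i \<in> R" and t: "0 \<le> t0" "t0 \<le> t1" "t1 \<in> time_interval (T i)"
    and M: "\<And>\<tau>. \<tau> \<in> {t0..t1} \<Longrightarrow> w (X i \<tau>) (V i \<tau>) \<le> M"
  obtain v' T' where v': "v' \<in> inputs" "solution f v' T' (\<lambda>s. X i (t0 + s))"
    "t1 - t0 \<in> time_interval T'" and eq: "\<And>s. s \<in> {0..t1 - t0} \<Longrightarrow> v' s = V i (t0 + s)"
    using solution_restart[of "T i" "X i" f "V i", OF X[OF i] V[OF i] t] by metis
  have "w (X i (t0 + \<tau>)) (v' \<tau>) \<le> M" if "\<tau> \<in> {0..t1 - t0}" for \<tau>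
    using M[of "t0 + \<tau>"] that eq[OF that] by simp
  from estimate[OF v' this]
  show "norm (X i t1) \<le> \<beta> (norm (X i t0)) (t1 - t0) + \<gamma> M" by simp
qed (use X0 in auto)

lemma dominated_zero_detectable:
  fixes X :: "'i \<Rightarrow> real \<Rightarrow> 'x::euclidean_space" and V :: "'i \<Rightarrow> real \<Rightarrow> 'v::euclidean_space"
    and h :: "'x \<Rightarrow> 'w::euclidean_space"
  assumes "zero_detectable f h"
    and X: "\<And>i t. i \<in> R \<Longrightarrow> t \<in> time_interval (T i) \<Longrightarrow>
      (X i has_vector_derivative f (X i t) (V i t)) (at t within time_interval (T i))"
    and V: "\<And>i. i \<in> R \<Longrightarrow> continuous_on (time_interval (T i)) (V i)"
    and dV: "dominated (\<lambda>i t. norm (V i t))" and dh: "dominated (\<lambda>i t. norm (h (X i t)))"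
    and X0: "\<And>i. i \<in> R \<Longrightarrow> norm (X i 0) \<le> s i"
  shows "dominated (\<lambda>i t. norm (X i t))"
proof -
  obtain \<beta> \<gamma>1 \<gamma>2 where \<beta>: "\<beta> \<in> class_KL" and \<gamma>: "\<gamma>1 \<in> class_K" "\<gamma>2 \<in> class_K"
    and estimate: "\<And>v T x t. v \<in> inputs \<Longrightarrow> solution f v T x \<Longrightarrow> t \<in> time_interval T \<Longrightarrow>
      norm (x t) \<le> \<beta> (norm (x 0)) t + \<gamma>1 (sup_norm v 0 t) + \<gamma>2 (sup_norm (\<lambda>s. h (x s)) 0 t)"
    using assms(1) class_K_inf_imp_class_K unfolding zero_detectable_def by metis
  \<comment> \<open>A single driving signal is required, so the norms of input and output are added;
    M then bounds both, and the two gains add up.\<close>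
  show ?thesis
  proof (rule dominated_state[where w = "\<lambda>x v. norm v + norm (h x)",
        OF \<beta> class_K_add[OF \<gamma>] _ X V dominated_add[OF dV dh] X0])
    fix v :: "real \<Rightarrow> 'v" and T :: ereal and x :: "real \<Rightarrow> 'x" and t M :: real
    assume v: "v \<in> inputs" "solution f v T x" "t \<in> time_interval T"
      and M: "\<And>\<tau>. \<tau> \<in> {0..t} \<Longrightarrow> norm (v \<tau>) + norm (h (x \<tau>)) \<le> M"
    have "norm (v \<tau>) \<le> M" "norm (h (x \<tau>)) \<le> M" if "\<tau> \<in> {0..t}" for \<tau>
      using M[OF that] norm_ge_zero[of "v \<tau>"] norm_ge_zero[of "h (x \<tau>)"] by linarith+
    then have "sup_norm v 0 t \<le> M" "sup_norm (\<lambda>s. h (x s)) 0 t \<le> M"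
      using time_interval_nonneg[OF v(3)] by (auto intro!: sup_norm_le)
    then have "\<gamma>1 (sup_norm v 0 t) \<le> \<gamma>1 M" "\<gamma>2 (sup_norm (\<lambda>s. h (x s)) 0 t) \<le> \<gamma>2 M"
      using \<gamma> class_K_mono sup_norm_nonneg by metis+
    with estimate[OF v] show "norm (x t) \<le> \<beta> (norm (x 0)) t + (\<gamma>1 M + \<gamma>2 M)" by linarith
  qed
qed

end

section \<open>The closed loop\<close>

lemma abs_nth_le_vec_norm: "k < n \<Longrightarrow> \<bar>z k\<bar> \<le> vec_norm n z"
  using member_le_L2_set[of "{..<n}" k "\<lambda>i. \<bar>z i\<bar>"] by (simp add: L2_set_def)

lemma vec_norm_mono_dim: "m \<le> n \<Longrightarrow> vec_norm m z \<le> vec_norm n z"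
  unfolding L2_set_def by (intro real_sqrt_le_mono sum_mono2) auto

lemma vec_norm_diff_le: "vec_norm n (\<lambda>k. y k - z k) \<le> vec_norm n y + vec_norm n z"
proof -
  have "vec_norm n (\<lambda>k. y k - z k) = vec_norm n (\<lambda>k. y k + - z k)" by simp
  also have "\<dots> \<le> vec_norm n y + vec_norm n (\<lambda>k. - z k)" by (rule L2_set_triangle_ineq)
  also have "vec_norm n (\<lambda>k. - z k) = vec_norm n z" by (simp add: L2_set_def)
  finally show ?thesis .
qed

lemma vec_norm_cong: "(\<And>k. k < n \<Longrightarrow> y k = z k) \<Longrightarrow> vec_norm n y = vec_norm n z"
  by (rule L2_set_cong) auto

lemma smooth_injected_field:
  assumes fE: "smooth (\<lambda>(x, y, u). fE x y u)" and fC: "smooth (\<lambda>(x, y). fC x y)"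
    and hq: "smooth hq" and hC: "smooth hC"
  shows "smooth (\<lambda>(x, e). injected_field fE hq fC hC x e)"
proof -
  let ?y = "\<lambda>z. hq (fst (fst z)) - snd z"
  have "smooth (\<lambda>z. (case (fst (fst z), ?y z, hC (snd (fst z))) of (x, y, u) \<Rightarrow> fE x y u,
      case (snd (fst z), ?y z) of (x, y) \<Rightarrow> fC x y))"
    by (intro smooth_Pair smooth_compose[OF fE] smooth_compose[OF fC] smooth_diff
        smooth_compose[OF hq] smooth_compose[OF hC] smooth_fst smooth_snd smooth_ident)
  then show ?thesis by (simp add: injected_field_def case_prod_unfold)
qed

lemma smooth_closed_loop_field:
  assumes fP: "smooth (\<lambda>(x, u). fP x u)" and hP: "smooth hP"
    and fE: "smooth (\<lambda>(x, y, u). fE x y u)" and fC: "smooth (\<lambda>(x, y). fC x y)" and hC: "smooth hC"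
  shows "smooth (closed_loop_field fP hP fE fC hC)"
proof -
  let ?y = "\<lambda>x. hP (fst x)" and ?u = "\<lambda>x. hC (snd (snd x))"
  have "smooth (\<lambda>x. (case (fst x, ?u x) of (x, u) \<Rightarrow> fP x u,
      case (fst (snd x), ?y x, ?u x) of (x, y, u) \<Rightarrow> fE x y u,
      case (snd (snd x), ?y x) of (x, y) \<Rightarrow> fC x y))"
    by (intro smooth_Pair smooth_compose[OF fP] smooth_compose[OF fE] smooth_compose[OF fC]
        smooth_compose[OF hP] smooth_compose[OF hC] smooth_fst smooth_snd smooth_ident)
  then show ?thesis by (simp add: closed_loop_field_def case_prod_unfold)
qed

lemma closed_loop_weakly_zero_detectable:
  fixes fP :: "'p::euclidean_space \<Rightarrow> real \<Rightarrow> 'p" and fC :: "'c::euclidean_space \<Rightarrow> real \<Rightarrow> 'c"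
    and fE :: "'e::euclidean_space \<Rightarrow> real \<Rightarrow> real \<Rightarrow> 'e"
  assumes fP: "smooth (\<lambda>(x, u). fP x u)" and hP: "smooth hP"
    and fC: "smooth (\<lambda>(x, y). fC x y)" and hC: "smooth hC"
    and fE: "smooth (\<lambda>(x, y, u). fE x y u)" and hq: "smooth hq"
    and degree: "relative_degree fP hP r"
    and min_phase: "strongly_minimum_phase fP hP"
    and ios: "injected_ios fE hq fC hC r"
    and detC: "zero_detectable fC hC"
    and detE: "zero_detectable (\<lambda>x (y, u). fE x y u) hq"
  shows "weakly_zero_detectable (closed_loop_field fP hP fE fC hC)
    (\<lambda>(xP, xE, xC). hq xE - hP xP) r"
proof -
  define F where "F = closed_loop_field fP hP fE fC hC"
  \<comment> \<open>All closed-loop trajectories together with their intervals. Domination over this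
    index set yields comparison functions independent of the trajectory.\<close>
  define R where "R = {(T, x). 0 < T \<and> (\<forall>t\<in>time_interval T.
    (x has_vector_derivative F (x t)) (at t within time_interval T))}"
  define T :: "ereal \<times> (real \<Rightarrow> 'p \<times> 'e \<times> 'c) \<Rightarrow> ereal" where "T = fst"
  define I where "I = (\<lambda>i. time_interval (T i))"
  define xP where "xP = (\<lambda>(i :: ereal \<times> (real \<Rightarrow> 'p \<times> 'e \<times> 'c)) t. fst (snd i t))"
  define xE where "xE = (\<lambda>(i :: ereal \<times> (real \<Rightarrow> 'p \<times> 'e \<times> 'c)) t. fst (snd (snd i t)))"
  define xC where "xC = (\<lambda>(i :: ereal \<times> (real \<Rightarrow> 'p \<times> 'e \<times> 'c)) t. snd (snd (snd i t)))"
  define u where "u = (\<lambda>i t. hC (xC i t))"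
  define y where "y = (\<lambda>i t. hP (xP i t))"
  define yq where "yq = (\<lambda>i t. hq (xE i t))"
  define e where "e = (\<lambda>i t. yq i t - y i t)"
  define s where "s = (\<lambda>(i :: ereal \<times> (real \<Rightarrow> 'p \<times> 'e \<times> 'c)). norm (snd i 0))"
  \<comment> \<open>\<open>Suc r\<close> entries cover the derivatives of orders 0 to r, so that E
    below is the norm in the conclusion.\<close>
  define jet_norm where "jet_norm = (\<lambda>z i t. vec_norm (Suc r) (jet (I i) (z i) t))"
  define E where "E = (\<lambda>i t. sup_norm (\<lambda>\<tau>. jet_norm e i \<tau>) 0 t)"
  have "0 < r" using degree by (simp add: relative_degree_def)

  have ne: "at t within I i \<noteq> bot" if "t \<in> I i" for i t
    using at_within_time_interval_ne_bot that by (simp add: I_def)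
  have sub: "{0..t} \<subseteq> I i" if "t \<in> I i" for i t
    using that Icc_subset_time_interval[of 0] by (simp add: I_def)
  have nonneg: "0 \<le> t" if "t \<in> I i" for i t
    using that time_interval_nonneg by (auto simp: I_def)
  have x': "(snd i has_vector_derivative F (snd i t)) (at t within I i)" if "i \<in> R" "t \<in> I i" for i t
    using that by (auto simp: R_def I_def T_def)
  have F: "F (snd i t) = (fP (xP i t) (u i t), fE (xE i t) (y i t) (u i t), fC (xC i t) (y i t))" for i t
    by (simp add: F_def closed_loop_field_def xP_def xE_def xC_def u_def y_def case_prod_unfold)
  have xP': "(xP i has_vector_derivative fP (xP i t) (u i t)) (at t within I i)"
    and xE': "(xE i has_vector_derivative fE (xE i t) (y i t) (u i t)) (at t within I i)"
    and xC': "(xC i has_vector_derivative fC (xC i t) (y i t)) (at t within I i)"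
    if "i \<in> R" "t \<in> I i" for i t
  proof -
    note x' = x'[OF that, unfolded F]
    show "(xP i has_vector_derivative fP (xP i t) (u i t)) (at t within I i)"
      using bounded_linear.has_vector_derivative[OF bounded_linear_fst x'] by (simp add: xP_def[abs_def])
    note x'' = bounded_linear.has_vector_derivative[OF bounded_linear_snd x', unfolded snd_conv]
    show "(xE i has_vector_derivative fE (xE i t) (y i t) (u i t)) (at t within I i)"
      using bounded_linear.has_vector_derivative[OF bounded_linear_fst x''] by (simp add: xE_def[abs_def])
    show "(xC i has_vector_derivative fC (xC i t) (y i t)) (at t within I i)"
      using bounded_linear.has_vector_derivative[OF bounded_linear_snd x''] by (simp add: xC_def[abs_def])
  qed
  have smooth_output: "smooth_signal (I i) (\<lambda>t. g (snd i t))" if "i \<in> R" "smooth g"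
    for i and g :: "'p \<times> 'e \<times> 'c \<Rightarrow> real"
    using smooth_signal_autonomous[of F g "I i" "snd i"] x'[OF that(1)] ne that(2)
      smooth_closed_loop_field[OF fP hP fE fC hC] by (simp add: F_def)
  have u: "smooth_signal (I i) (u i)" and y: "smooth_signal (I i) (y i)"
    and yq: "smooth_signal (I i) (yq i)" and e: "smooth_signal (I i) (e i)" if "i \<in> R" for i
    using smooth_output[OF that smooth_compose[OF hC smooth_snd[OF smooth_snd[OF smooth_ident]]]]
      smooth_output[OF that smooth_compose[OF hP smooth_fst[OF smooth_ident]]]
      smooth_output[OF that smooth_compose[OF hq smooth_fst[OF smooth_snd[OF smooth_ident]]]]
      smooth_output[OF that smooth_diff[OF smooth_compose[OF hq smooth_fst[OF smooth_snd[OF smooth_ident]]]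
          smooth_compose[OF hP smooth_fst[OF smooth_ident]]]]
    by (simp_all add: u_def[abs_def] y_def[abs_def] yq_def[abs_def] e_def[abs_def]
        xP_def[abs_def] xE_def[abs_def] xC_def[abs_def])
  have continuous_signal: "continuous_on (I i) z" if "smooth_signal (I i) z" for i z
    using smooth_signal_continuous_on[OF that, of 0] by simp

  \<comment> \<open>Continuity of the jet turns E, an essential supremum, into a pointwise
    bound.\<close>
  have "continuous_on (I i) (jet_norm e i)" if "i \<in> R" for i
    unfolding jet_norm_def jet_def L2_set_def
    by (intro continuous_intros smooth_signal_continuous_on[OF e[OF that]])
  then have "norm (jet_norm e i \<tau>) \<le> E i t" if "i \<in> R" "t \<in> I i" "\<tau> \<in> {0..t}" for i t \<tau>
    unfolding E_def using that by (intro norm_le_sup_norm continuous_on_subset[OF _ sub])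
  then have jet_e_le: "jet_norm e i \<tau> \<le> E i t" if "i \<in> R" "t \<in> I i" "\<tau> \<in> {0..t}" for i t \<tau>
    using that order_trans[OF abs_ge_self] by (metis real_norm_def)
  have jet_norm_nonneg: "0 \<le> jet_norm z i t" for z i t
    by (simp add: jet_norm_def)
  interpret comparison R T s E
  proof
    fix i t t' assume i: "i \<in> R" and t': "t' \<in> time_interval (T i)" and t: "0 \<le> t" "t \<le> t'"
    have "norm (jet_norm e i \<tau>) \<le> E i t'" if "\<tau> \<in> {0..t}" for \<tau>
      using jet_e_le[OF i, of t' \<tau>] jet_norm_nonneg[of e i \<tau>] that t t' by (simp add: I_def)
    \<comment> \<open>Monotonicity of E goes through pointwise values, which also covers the
      degenerate interval at t = 0.\<close>
    then have "sup_norm (\<lambda>\<tau>. jet_norm e i \<tau>) 0 t \<le> E i t'"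
      using t(1) by (intro sup_norm_le)
    then show "E i t \<le> E i t'" by (simp add: E_def)
  qed (auto simp: s_def E_def sup_norm_nonneg)

  have xP_0: "norm (xP i 0) \<le> s i" and xE_0: "norm (xE i 0) \<le> s i" and xC_0: "norm (xC i 0) \<le> s i"
    and xEC_0: "norm (xE i 0, xC i 0) \<le> s i" for i
    using norm_fst_le[of "fst (snd i 0)" "snd (snd i 0)"] norm_snd_le[of "snd (snd i 0)" "fst (snd i 0)"]
      norm_fst_le[of "fst (snd (snd i 0))" "snd (snd (snd i 0))"]
      norm_snd_le[of "snd (snd (snd i 0))" "fst (snd (snd i 0))"]
    by (simp_all add: xP_def xE_def xC_def s_def)

  \<comment> \<open>Input-to-output stability bounds the output at time t itself, so the estimate
    already has the required form. The work is to replace e_q by an admissible input on the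
    half-line.\<close>
  have dom_yq: "dominated (jet_norm yq)"
  proof -
    obtain \<beta> \<gamma> where \<beta>: "\<beta> \<in> class_KL" and \<gamma>: "\<gamma> \<in> class_K"
      and estimate: "\<And>v T x t. v \<in> jet {0..} ` C_on (r - 1) {0..} \<Longrightarrow>
        solution (\<lambda>x v. injected_field fE hq fC hC x (v 0)) v T x \<Longrightarrow> t \<in> time_interval T \<Longrightarrow>
        vec_norm (Suc r) (\<lambda>k. output_deriv (injected_field fE hq fC hC) (\<lambda>(xE, xC). hq xE) k (x t) (v t))
          \<le> \<beta> (norm (x 0)) t + \<gamma> (sup_norm (\<lambda>s. vec_norm r (v s)) 0 t)"
      using ios class_K_inf_imp_class_K unfolding injected_ios_def input_to_output_stable_def by metis
    show ?thesis
    proof (rule dominatedI[OF \<beta> \<gamma>])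
      fix i t assume i: "i \<in> R" and "t \<in> time_interval (T i)"
      then have t: "t \<in> I i" by (simp add: I_def)
      obtain t1 where t1: "t < t1" "t1 \<in> I i"
        using ereal_less_time_interval t unfolding I_def by metis
      \<comment> \<open>Stability admits inputs of class C^(r-1). Agreement up to t1 > t makes t a
        time of the half-open interval [0, t1) on which the solution is considered.\<close>
      obtain w where w: "w \<in> C_on (r - 1) {0..}"
        and jet_w: "\<And>k \<tau>. k \<le> r - 1 \<Longrightarrow> \<tau> \<in> {0..t1} \<Longrightarrow> jet {0..} w \<tau> k = jet (I i) (e i) \<tau> k"
        using smooth_signal_extension[of "T i" "e i" t1 "r - 1"] e[OF i] t1(2) unfolding I_def by metis
      let ?x = "\<lambda>\<tau>. (xE i \<tau>, xC i \<tau>)" and ?f = "injected_field fE hq fC hC"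
      let ?h = "\<lambda>(xE :: 'e, xC :: 'c). hq xE"
      \<comment> \<open>Substituting y = y_q - e_q turns the closed-loop equations of estimator and
        controller into the injected system.\<close>
      have x_deriv: "(?x has_vector_derivative ?f (?x \<tau>) (e i \<tau>)) (at \<tau> within I i)" if "\<tau> \<in> I i" for \<tau>
        using has_vector_derivative_Pair[OF xE'[OF i that] xC'[OF i that]]
        by (simp add: injected_field_def e_def yq_def u_def)
      have sol: "solution (\<lambda>x v. ?f x (v 0)) (jet {0..} w) (ereal t1) ?x"
      proof (rule solutionI)
        show "0 < ereal t1" using t1 nonneg[OF t] by (simp add: zero_ereal_def)
        fix \<tau> assume "\<tau> \<in> time_interval (ereal t1)"
        then have \<tau>: "\<tau> \<in> {0..t1}" by (simp add: time_interval_def)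
        have "jet {0..} w \<tau> 0 = e i \<tau>"
          using jet_w[OF _ \<tau>, of 0] by (simp add: jet_def)
        moreover have "(?x has_vector_derivative ?f (?x \<tau>) (e i \<tau>)) (at \<tau> within time_interval (ereal t1))"
        proof (rule has_vector_derivative_within_subset[OF x_deriv])
          show "\<tau> \<in> I i" using sub[OF t1(2)] \<tau> by blast
          show "time_interval (ereal t1) \<subseteq> I i"
            using sub[OF t1(2)] by (auto simp: time_interval_def)
        qed
        ultimately show "(?x has_vector_derivative ?f (?x \<tau>) (jet {0..} w \<tau> 0))
            (at \<tau> within time_interval (ereal t1))" by simp
      qed
      have "smooth ?h"
        unfolding case_prod_unfold by (intro smooth_compose[OF hq] smooth_intros)
      note nth = smooth_signal_output(2)[OF smooth_injected_field[OF fE fC hq hC] this ne e[OF i] x_deriv t]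
      have "nth_deriv (I i) (yq i) k t = output_deriv ?f ?h k (?x t) (jet {0..} w t)" if "k < Suc r" for k
      proof -
        have "nth_deriv (I i) (yq i) k t = output_deriv ?f ?h k (?x t) (jet (I i) (e i) t)"
          using nth[of k] by (simp add: yq_def[abs_def])
        \<comment> \<open>For k \<le> r, H_k reads only entries below r, that is, derivatives of
          order at most r - 1, where the jets of w and e_q agree.\<close>
        also have "\<dots> = output_deriv ?f ?h k (?x t) (jet {0..} w t)"
          using that t1(1) nonneg[OF t] by (intro output_deriv_cong jet_w[symmetric]) auto
        finally show ?thesis .
      qed
      then have "jet_norm yq i t = vec_norm (Suc r) (\<lambda>k. output_deriv ?f ?h k (?x t) (jet {0..} w t))"
        unfolding jet_norm_def by (intro vec_norm_cong) (simp add: jet_def)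
      also have "\<dots> \<le> \<beta> (norm (?x 0)) t + \<gamma> (sup_norm (\<lambda>\<tau>. vec_norm r (jet {0..} w \<tau>)) 0 t)"
        by (rule estimate[OF imageI[OF w] sol]) (use nonneg[OF t] t1 in \<open>simp add: time_interval_def\<close>)
      also have "\<beta> (norm (?x 0)) t \<le> \<beta> (s i) t"
        by (rule class_KL_mono[OF \<beta> norm_ge_zero xEC_0 nonneg[OF t]])
      also have "\<gamma> (sup_norm (\<lambda>\<tau>. vec_norm r (jet {0..} w \<tau>)) 0 t) \<le> \<gamma> (E i t)"
      proof (intro class_K_mono[OF \<gamma> sup_norm_nonneg] sup_norm_le nonneg[OF t])
        fix \<tau> assume \<tau>: "\<tau> \<in> {0..t}"
        have "vec_norm r (jet {0..} w \<tau>) = vec_norm r (jet (I i) (e i) \<tau>)"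
          by (intro vec_norm_cong jet_w) (use \<tau> t1 in auto)
        also have "\<dots> \<le> jet_norm e i \<tau>"
          unfolding jet_norm_def by (rule vec_norm_mono_dim) simp
        also have "\<dots> \<le> E i t"
          by (rule jet_e_le[OF i t \<tau>])
        finally show "norm (vec_norm r (jet {0..} w \<tau>)) \<le> E i t" by simp
      qed
      finally show "jet_norm yq i t \<le> \<beta> (s i) t + \<gamma> (E i t)" by simp
    qed
  qed

  \<comment> \<open>The r-th derivative of e_q enters here, one order beyond the inputs in the
    stability hypothesis.\<close>
  have dom_y: "dominated (jet_norm y)"
  proof (rule dominated_le_add_E[OF dom_yq])
    fix i t assume i: "i \<in> R" and "t \<in> time_interval (T i)"
    then have t: "t \<in> I i" by (simp add: I_def)
    have "jet (I i) (y i) t k = jet (I i) (yq i) t k - jet (I i) (e i) t k" for k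
      using nth_deriv_diff[OF ne yq[OF i] e[OF i] t, of k] by (simp add: jet_def e_def)
    then have "jet_norm y i t = vec_norm (Suc r) (\<lambda>k. jet (I i) (yq i) t k - jet (I i) (e i) t k)"
      unfolding jet_norm_def by (intro vec_norm_cong)
    also have "\<dots> \<le> jet_norm yq i t + jet_norm e i t"
      unfolding jet_norm_def by (rule vec_norm_diff_le)
    also have "jet_norm e i t \<le> E i t"
      using jet_e_le[OF i t, of t] nonneg[OF t] by simp
    finally show "jet_norm y i t \<le> jet_norm yq i t + E i t" by simp
  qed
  have abs_le_jet_norm: "\<bar>z i t\<bar> \<le> jet_norm z i t" for z i t
    using abs_nth_le_vec_norm[of 0 "Suc r" "jet (I i) (z i) t"] by (simp add: jet_norm_def jet_def)
  have dom_abs_y: "dominated (\<lambda>i t. \<bar>y i t\<bar>)"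
    by (rule dominated_mono[OF dom_y abs_le_jet_norm])
  have dom_abs_yq: "dominated (\<lambda>i t. \<bar>yq i t\<bar>)"
    by (rule dominated_mono[OF dom_yq abs_le_jet_norm])

  have nth_y: "nth_deriv (I i) (y i) k t = output_deriv fP hP k (xP i t) (jet (I i) (u i) t)"
    if "i \<in> R" "t \<in> I i" for i t k
    using smooth_signal_output(2)[OF fP hP ne u[OF that(1)] xP'[OF that(1)] that(2), of k]
    by (simp add: y_def[abs_def])

  have dom_xP: "dominated (\<lambda>i t. norm (xP i t))"
  proof -
    obtain r' \<beta> \<gamma> where r': "relative_degree fP hP r'" and \<beta>: "\<beta> \<in> class_KL" and \<gamma>: "\<gamma> \<in> class_K"
      and estimate: "\<And>u T x t. u \<in> inputs \<Longrightarrow> solution fP u T x \<Longrightarrow> t \<in> time_interval T \<Longrightarrow>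
        norm (x t) \<le> \<beta> (norm (x 0)) t
          + \<gamma> (sup_norm (\<lambda>s. vec_norm r' (\<lambda>k. output_deriv fP hP k (x s) (\<lambda>_. 0))) 0 t)"
      using min_phase class_K_inf_imp_class_K unfolding strongly_minimum_phase_def by metis
    have r': "r' = r" by (rule relative_degree_unique[OF r' degree])
    let ?w = "\<lambda>x (v::real). vec_norm r (\<lambda>k. output_deriv fP hP k x (\<lambda>_. 0))"
    show ?thesis
    proof (rule dominated_state[where w = ?w, OF \<beta> \<gamma> _ xP'[unfolded I_def]
          continuous_signal[OF u, unfolded I_def] dominated_mono[OF dom_y] xP_0])
      fix v :: "real \<Rightarrow> real" and T :: ereal and x :: "real \<Rightarrow> 'p" and t M :: real
      assume v: "v \<in> inputs" "solution fP v T x" "t \<in> time_interval T"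
        and M: "\<And>\<tau>. \<tau> \<in> {0..t} \<Longrightarrow> ?w (x \<tau>) (v \<tau>) \<le> M"
      have "sup_norm (\<lambda>s. ?w (x s) (v s)) 0 t \<le> M"
        using M time_interval_nonneg[OF v(3)] by (intro sup_norm_le) auto
      then have "\<gamma> (sup_norm (\<lambda>s. ?w (x s) (v s)) 0 t) \<le> \<gamma> M"
        by (rule class_K_mono[OF \<gamma> sup_norm_nonneg])
      with estimate[OF v] show "norm (x t) \<le> \<beta> (norm (x 0)) t + \<gamma> M" by (simp add: r')
    next
      fix i t assume i: "i \<in> R" and "t \<in> time_interval (T i)"
      then have t: "t \<in> I i" by (simp add: I_def)
      \<comment> \<open>Below the relative degree H_k ignores the input, so zeros may replace the
        jet of u.\<close>
      have "output_deriv fP hP k (xP i t) (\<lambda>_. 0) = jet (I i) (y i) t k" if "k < r" for k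
        using degree that unfolding jet_def nth_y[OF i t] relative_degree_def by blast
      then have "?w (xP i t) (u i t) = vec_norm r (jet (I i) (y i) t)"
        by (intro vec_norm_cong)
      also have "\<dots> \<le> jet_norm y i t"
        unfolding jet_norm_def by (rule vec_norm_mono_dim) simp
      finally show "?w (xP i t) (u i t) \<le> jet_norm y i t" .
    qed
  qed

  \<comment> \<open>The bound on u is read off from the process, with y^(r) as the last entry of the
    jet of y. The controller comes in only afterwards, with y as its input and the bounded u as its
    output.\<close>
  have dom_abs_u: "dominated (\<lambda>i t. \<bar>u i t\<bar>)"
  proof -
    obtain \<rho>1 \<rho>2 where \<rho>: "\<rho>1 \<in> class_K" "\<rho>2 \<in> class_K"
      and le: "\<And>x u. \<bar>u 0\<bar> \<le> \<rho>1 (norm x) + \<rho>2 \<bar>output_deriv fP hP r x u\<bar>"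
      using degree class_K_inf_imp_class_K unfolding relative_degree_def by metis
    show ?thesis
    proof (rule dominated_mono[OF dominated_add[OF
            dominated_class_K[OF dom_xP \<rho>(1)] dominated_class_K[OF dom_y \<rho>(2)]]])
      fix i t assume i: "i \<in> R" and "t \<in> time_interval (T i)"
      then have t: "t \<in> I i" by (simp add: I_def)
      have "\<bar>output_deriv fP hP r (xP i t) (jet (I i) (u i) t)\<bar> \<le> jet_norm y i t"
        using abs_nth_le_vec_norm[of r "Suc r" "jet (I i) (y i) t"]
        by (simp add: jet_norm_def jet_def nth_y[OF i t])
      from class_K_mono[OF \<rho>(2) abs_ge_zero this] le[of "jet (I i) (u i) t" "xP i t"]
      show "\<bar>u i t\<bar> \<le> \<rho>1 (norm (xP i t)) + \<rho>2 (jet_norm y i t)"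
        by (simp add: jet_def)
    qed (auto simp: jet_norm_nonneg)
  qed

  have dom_xC: "dominated (\<lambda>i t. norm (xC i t))"
    by (rule dominated_zero_detectable[OF detC xC'[unfolded I_def] continuous_signal[OF y, unfolded I_def]])
      (use dom_abs_y dom_abs_u xC_0 in \<open>simp_all add: u_def\<close>)

  have dom_xE: "dominated (\<lambda>i t. norm (xE i t))"
  proof (rule dominated_zero_detectable[OF detE, where V = "\<lambda>i t. (y i t, u i t)"])
    show "dominated (\<lambda>i t. norm (y i t, u i t))"
      by (rule dominated_mono[OF dominated_add[OF dom_abs_y dom_abs_u]])
        (use norm_Pair_le[of "y _ _" "u _ _"] in simp)
    show "continuous_on (time_interval (T i)) (\<lambda>t. (y i t, u i t))" if "i \<in> R" for i
      using continuous_signal[OF y[OF that]] continuous_signal[OF u[OF that]]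
      by (auto simp: I_def intro: continuous_on_Pair)
  qed (use xE' dom_abs_yq xE_0 in \<open>simp_all add: yq_def I_def\<close>)

  obtain \<beta> \<gamma> where \<beta>: "\<beta> \<in> class_KL" and \<gamma>: "\<gamma> \<in> class_K"
    and le: "\<And>i t. i \<in> R \<Longrightarrow> t \<in> time_interval (T i) \<Longrightarrow>
      norm (xP i t) + (norm (xE i t) + norm (xC i t)) \<le> \<beta> (s i) t + \<gamma> (E i t)"
    using dominated_add[OF dom_xP dominated_add[OF dom_xE dom_xC]] unfolding dominated_def by metis
  \<comment> \<open>The added E supplies the identity that makes the final gain unbounded.\<close>
  have bound: "norm (snd i t) \<le> \<beta> (s i) t + (\<gamma> (E i t) + E i t)"
    if i: "i \<in> R" and t: "t \<in> time_interval (T i)" for i t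
  proof -
    have "snd i t = (xP i t, xE i t, xC i t)"
      by (simp add: xP_def xE_def xC_def)
    then have "norm (snd i t) \<le> norm (xP i t) + (norm (xE i t) + norm (xC i t))"
      using norm_Pair_le[of "xP i t" "(xE i t, xC i t)"] norm_Pair_le[of "xE i t" "xC i t"] by simp
    with le[OF i t] E_nonneg[OF i t] show ?thesis by simp
  qed
  show ?thesis
    unfolding weakly_zero_detectable_def
  proof (intro bexI[OF _ \<beta>] bexI[OF _ class_K_add_ident_class_K_inf[OF \<gamma>]] allI impI ballI)
    fix T' x t
    assume x: "0 < T' \<and> (\<forall>t\<in>time_interval T'. (x has_vector_derivative
        closed_loop_field fP hP fE fC hC (x t)) (at t within time_interval T'))"
      and t: "t \<in> time_interval T'"
    have "(T', x) \<in> R" using x by (simp add: R_def F_def)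
    from bound[OF this, of t] t
    show "norm (x t) \<le> \<beta> (norm (x 0)) t +
        (\<gamma> (sup_norm (\<lambda>s. vec_norm (Suc r) (jet (time_interval T')
            (\<lambda>\<tau>. case x \<tau> of (xP, xE, xC) \<Rightarrow> hq xE - hP xP) s)) 0 t)
         + sup_norm (\<lambda>s. vec_norm (Suc r) (jet (time_interval T')
            (\<lambda>\<tau>. case x \<tau> of (xP, xE, xC) \<Rightarrow> hq xE - hP xP) s)) 0 t)"
      by (simp add: T_def s_def E_def jet_norm_def I_def e_def[abs_def] yq_def y_def xE_def xP_def
          case_prod_unfold)
  qed
qed

theorem theorem3:
  fixes \<P> :: "'i set" and q :: 'i and r :: nat
    and fP :: "'p::euclidean_space \<Rightarrow> real \<Rightarrow> 'p" and hP :: "'p \<Rightarrow> real"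
    and fC :: "'c::euclidean_space \<Rightarrow> real \<Rightarrow> 'i \<Rightarrow> 'c" and hC :: "'c \<Rightarrow> 'i \<Rightarrow> real"
    and fE :: "'e::euclidean_space \<Rightarrow> real \<Rightarrow> real \<Rightarrow> 'e" and h :: "'i \<Rightarrow> 'e \<Rightarrow> real"
  assumes "q \<in> \<P>"
    and "smooth (\<lambda>(x, u). fP x u)" and "smooth hP"
    and "\<And>p. p \<in> \<P> \<Longrightarrow> smooth (\<lambda>(x, y). fC x y p)"
    and "\<And>p. p \<in> \<P> \<Longrightarrow> smooth (\<lambda>x. hC x p)"
    and "smooth (\<lambda>(x, y, u). fE x y u)"
    and "\<And>p. p \<in> \<P> \<Longrightarrow> smooth (h p)"
    and "relative_degree fP hP r"
    and "strongly_minimum_phase fP hP"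
    and "injected_ios fE (h q) (\<lambda>x y. fC x y q) (\<lambda>x. hC x q) r"
    and "zero_detectable (\<lambda>x y. fC x y q) (\<lambda>x. hC x q)"
    and "zero_detectable (\<lambda>x (y, u). fE x y u) (h q)"
  shows "weakly_zero_detectable
           (closed_loop_field fP hP fE (\<lambda>x y. fC x y q) (\<lambda>x. hC x q))
           (\<lambda>(xP, xE, xC). h q xE - hP xP) r"
proof (rule closed_loop_weakly_zero_detectable)
  show "smooth (\<lambda>(x, y). fC x y q)" and "smooth (\<lambda>x. hC x q)" and "smooth (h q)"
    using assms(1,4,5,7) by auto
qed (fact assms)+

end
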